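(* Let $N$ be a Poisson random measure on $\mathcal{W}$ with sigma-finite nonatomic mean measure $\nu$, let $n\ge 1$, and let $(\mathbf{W},N)$ be the measurable element of $\mathcal{W}^n\times\mathcal{M}$ having the joint measure $\left[\prod_{i=1}^n N(dW_i)\right]\mathcal{P}(dN|\nu)$. Then the following disintegration of this joint measure holds: $$\left[\prod_{i=1}^n N(dW_i)\right]\mathcal{P}(dN|\nu)=\mathcal{P}(dN|\nu,\mathbf{W})\prod_{j=1}^{n(\mathbf{p})}\nu(dW_j^* ),$$ where, for given $\mathbf{W}$, $\mathcal{P}(dN|\nu,\mathbf{W})$ is the law of the random measure $N+\sum_{j=1}^{n(\mathbf{p})}\delta_{W_j^*}$ with $N$ distributed as $\mathcal{P}(dN|\nu)$ and the points $\mathbf{W}$ fixed; equivalently, it is the law on $\mathcal{M}$ with Laplace functional $$\int_{\mathcal{M}}e^{-N(f)}\,\mathcal{P}(dN|\nu,\mathbf{W})=\mathcal{L}_N(f|\nu)\prod_{j=1}^{n(\mathbf{p})}e^{-f(W_j^* )},\qquad f\in BM_+(\mathcal{W}).$$ The moment measure $M(d\mathbf{W}|\nu)=\int_{\mathcal{M}}\left[\prod_{i=1}^nN(dW_i)\right]\mathcal{P}(dN|\nu)$ is expressible via conditional moment measures as $$M(d\mathbf{W}|\nu)=\prod_{j=1}^{n(\mathbf{p})}\nu(dW_j^* )=\nu(dW_1)\prod_{i=2}^n\left[\nu(dW_i)+\sum_{j=1}^{n(\mathbf{p}_{i-1})}\delta_{W_j^*}(dW_i)\right],$$ where, in the $i$-th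 factor, $\mathbf{p}_{i-1}$ is the partition of $\{1,\ldots,i-1\}$ encoding the ties between $W_1,\ldots,W_{i-1}$, $n(\mathbf{p}_{i-1})$ is its number of cells, and $W_1^*,\ldots,W^*_{n(\mathbf{p}_{i-1})}$ are the distinct values among $W_1,\ldots,W_{i-1}$.
   Context: $\mathcal{W}$ is a Polish space (with a fixed complete separable metric, which determines the bounded sets). $\mathcal{M}$ is the space of boundedly finite Borel measures on $\mathcal{W}$ with its usual sigma-field. $\nu$ is finite on bounded Borel sets, and $\mathcal{P}(dN|\nu)$ is the law on $\mathcal{M}$ of a Poisson random measure with mean intensity $\nu$. $BM_+(\mathcal{W})$ is the class of nonnegative Borel measurable functions of bounded support, $N(f)=\int f\,dN$, and $\mathcal{L}_N(f|\nu)=\int_{\mathcal{M}} e^{-N(f)}\mathcal{P}(dN|\nu)=\exp(-\int_{\mathcal{W}}(1-e^{-f})\,d\nu)$. A vector $\mathbf{W}=(W_1,\ldots,W_n)\in\mathcal{W}^n$ is identified with the pair $(\mathbf{W}^*,\mathbf{p})$, where $\mathbf{W}^*=(W_1^*,\ldots,W^*_{n(\mathbf{p})})$ are its distinct values and $\mathbf{p}=\{C_1,\ldots,C_{n(\mathbf{p})}\}$ is the partition of $\{1,\ldots,n\}$ with cells $C_j=\{i:W_i=W_j^*\}$; $n(\mathbf{p})$ is the number of cells. The expression $\prod_{j=1}^{n(\mathbf{p})}\nu(dW_j^* )$ denotes the measure on $\mathcal{W}^n$ whose integral of a nonnegative measurable $g$ is $$\sum_{\mathbf{p}}\int_{\mathcal{W}^{n(\mathbf{p})}}g(w_1,\ldots,w_n)\prod_{j=1}^{n(\mathbf{p})}\nu(dw_j^*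 ),$$ where the sum is over all partitions $\mathbf{p}$ of $\{1,\ldots,n\}$ and, in the term for $\mathbf{p}$, $w_i=w_j^*$ for $i\in C_j$. Equality of measures on $\mathcal{W}^n\times\mathcal{M}$ means equality of the integrals of all nonnegative measurable functions $g(\mathbf{W},N)$. *)

theory Defs
  imports "HOL-Probability.Probability"
begin

section \<open>Boundedly finite measures\<close>

text \<open>The metric of the type \<^typ>\<open>'a::polish_space\<close> is the fixed complete separable metric on the
  state space; \<^const>\<open>bounded\<close> refers to it. The usual sigma-field on the space of boundedly finite
  Borel measures is the one generated by the evaluations at Borel sets.\<close>

definition bfm_set :: "'a::polish_space measure set" where
  "bfm_set = {N. sets N = sets borel \<and> (\<forall>A\<in>sets borel. bounded A \<longrightarrow> emeasure N A < \<infinity>)}"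

definition bfm :: "'a::polish_space measure measure" where
  "bfm = (SUP A\<in>sets borel. vimage_algebra bfm_set (\<lambda>N. emeasure N A) borel)"

lemma space_bfm [simp]: "space bfm = bfm_set"
  by (auto simp: bfm_def space_Sup_eq_UN)

lemma measurable_emeasure_bfm [measurable]:
  assumes "A \<in> sets borel"
  shows "(\<lambda>N. emeasure N A) \<in> borel_measurable (bfm :: 'a::polish_space measure measure)"
  unfolding bfm_def
  using assms
  by (intro measurable_Sup1[where m = "vimage_algebra bfm_set (\<lambda>N. emeasure N A) borel"]
        measurable_vimage_algebra1) auto

lemma measurable_bfmI:
  fixes f :: "'b \<Rightarrow> 'a::polish_space measure"
  assumes "\<And>x. x \<in> space M \<Longrightarrow> f x \<in> bfm_set"
    and "\<And>A. A \<in> sets borel \<Longrightarrow> (\<lambda>x. emeasure (f x) A) \<in> borel_measurable M"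
  shows "f \<in> measurable M bfm"
  unfolding bfm_def
proof (rule measurable_Sup2)
  fix m assume "m \<in> (\<lambda>A. vimage_algebra bfm_set (\<lambda>N. emeasure N A) borel) ` sets (borel :: 'a measure)"
  then show "f \<in> measurable M m"
    using assms by (auto intro!: measurable_vimage_algebra2)
qed auto

definition nonatomic :: "'a::polish_space measure \<Rightarrow> bool" where
  "nonatomic \<nu> \<longleftrightarrow> (\<forall>x. emeasure \<nu> {x} = 0)"


section \<open>Poisson laws and Laplace functionals\<close>

text \<open>The counts of a Poisson random measure are required to be Poisson distributed through their
  point probabilities rather than through \<^const>\<open>poisson_pmf\<close>, because the latter excludes the
  rate 0; here a null set has count 0 almost surely.\<close>

definition poisson_law :: "'a::polish_space measure \<Rightarrow> 'a measure measure \<Rightarrow> bool" where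
  "poisson_law \<nu> P \<longleftrightarrow> prob_space P \<and> sets P = sets bfm \<and>
     (\<forall>A\<in>sets borel. bounded A \<longrightarrow> (\<forall>k::nat.
        measure P {N \<in> space P. emeasure N A = of_nat k} =
          measure \<nu> A ^ k / fact k * exp (- measure \<nu> A))) \<and>
     (\<forall>(I::nat set) A. finite I \<longrightarrow> A ` I \<subseteq> {B \<in> sets borel. bounded B} \<longrightarrow>
        disjoint_family_on A I \<longrightarrow>
        prob_space.indep_vars P (\<lambda>_. borel) (\<lambda>i N. emeasure N (A i)) I)"

definition BM_plus :: "('a::polish_space \<Rightarrow> real) set" where
  "BM_plus = {f \<in> borel_measurable borel. (\<forall>x. 0 \<le> f x) \<and> bounded {x. f x \<noteq> 0}}"

definition exp_neg :: "ennreal \<Rightarrow> real" where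
  "exp_neg t = (if t = \<infinity> then 0 else exp (- enn2real t))"

text \<open>Functions in \<^const>\<open>BM_plus\<close> need not be bounded, so the integral of \<open>f\<close> with respect to \<open>N\<close>
  may be infinite, in which case \<^const>\<open>exp_neg\<close> of it is 0.\<close>

definition laplace :: "'a::polish_space measure measure \<Rightarrow> ('a \<Rightarrow> real) \<Rightarrow> real" where
  "laplace Q f = (\<integral>N. exp_neg (\<integral>\<^sup>+x. ennreal (f x) \<partial>N) \<partial>Q)"


section \<open>Adding point masses\<close>

text \<open>The measure \<open>N\<close> plus one unit mass at each element of the finite set \<open>S\<close>. In the sequel
  \<open>S\<close> is the set of distinct values among some coordinates of a vector, so every distinct value
  is charged once, irrespective of its multiplicity.\<close>

definition add_dirac :: "'a::polish_space measure \<Rightarrow> 'a set \<Rightarrow> 'a measure" where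
  "add_dirac N S = measure_of UNIV (sets borel) (\<lambda>A. emeasure N A + (\<Sum>x\<in>S. indicator A x))"

lemma space_add_dirac [simp]: "space (add_dirac N S) = UNIV"
  by (simp add: add_dirac_def space_measure_of_conv)

lemma sets_add_dirac [simp, measurable_cong]: "sets (add_dirac N S) = sets borel"
  using sets.sigma_sets_eq[of borel] by (simp add: add_dirac_def)

lemma emeasure_add_dirac:
  assumes "sets N = sets borel" "A \<in> sets borel"
  shows "emeasure (add_dirac N S) A = emeasure N A + (\<Sum>x\<in>S. indicator A x)"
proof (rule emeasure_measure_of[OF add_dirac_def])
  show "countably_additive (sets (add_dirac N S)) (\<lambda>A. emeasure N A + (\<Sum>x\<in>S. indicator A x))"
  proof (rule countably_additiveI)
    fix B :: "nat \<Rightarrow> 'a set"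
    assume B: "range B \<subseteq> sets (add_dirac N S)" "disjoint_family B"
    have "(\<Sum>i. emeasure N (B i) + (\<Sum>x\<in>S. indicator (B i) x)) =
        (\<Sum>i. emeasure N (B i)) + (\<Sum>i. \<Sum>x\<in>S. indicator (B i) x)"
      by (rule suminf_add[symmetric]) (auto intro: summableI)
    also have "(\<Sum>i. emeasure N (B i)) = emeasure N (\<Union>i. B i)"
      using B assms by (intro suminf_emeasure) auto
    also have "(\<Sum>i. \<Sum>x\<in>S. indicator (B i) x :: ennreal) = (\<Sum>x\<in>S. \<Sum>i. indicator (B i) x)"
      by (rule suminf_sum) (auto intro: summableI)
    also have "\<dots> = (\<Sum>x\<in>S. indicator (\<Union>i. B i) x)"
      using B(2) by (intro sum.cong refl suminf_indicator)
    finally show "(\<Sum>i. emeasure N (B i) + (\<Sum>x\<in>S. indicator (B i) x)) =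
        emeasure N (\<Union>i. B i) + (\<Sum>x\<in>S. indicator (\<Union>i. B i) x)" .
  qed
qed (use assms in \<open>auto simp: positive_def\<close>)

lemma add_dirac_bfm:
  assumes "N \<in> bfm_set" "finite S"
  shows "add_dirac N S \<in> bfm_set"
  using assms
  by (auto simp: bfm_set_def emeasure_add_dirac ennreal_add_less_top less_top[symmetric]
      indicator_def)

lemma measurable_add_dirac [measurable]:
  assumes "finite S"
  shows "(\<lambda>N. add_dirac N S) \<in> measurable bfm bfm"
proof (rule measurable_bfmI)
  fix A :: "'a set" assume A: "A \<in> sets borel"
  have "(\<lambda>N. emeasure N A + (\<Sum>x\<in>S. indicator A x)) \<in> borel_measurable bfm"
    using A by measurable
  then show "(\<lambda>N. emeasure (add_dirac N S) A) \<in> borel_measurable bfm"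
    by (rule measurable_cong[THEN iffD1, rotated])
       (use A in \<open>auto simp: bfm_set_def emeasure_add_dirac\<close>)
qed (use assms in \<open>auto intro: add_dirac_bfm\<close>)

text \<open>The conditional law of the random measure given the vector \<open>W\<close>, that is the law of \<open>N\<close> plus
  unit masses at the distinct values of \<open>W\<close>, with \<open>N\<close> distributed as \<open>P\<close> and \<open>W\<close> fixed. Vectors of
  length \<open>n\<close> are elements of the product space over \<^term>\<open>{1..n}\<close>.\<close>

definition law_given :: "nat \<Rightarrow> 'a::polish_space measure measure \<Rightarrow> (nat \<Rightarrow> 'a) \<Rightarrow> 'a measure measure"
  where "law_given n P W = distr P bfm (\<lambda>N. add_dirac N (W ` {1..n}))"


section \<open>Mixtures of measures\<close>

text \<open>The measure \<open>A \<mapsto> \<integral> \<kappa>(x)(A) M(dx)\<close> on \<open>K\<close>. Unlike \<^const>\<open>Giry_Monad.bind\<close> this is not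
  restricted to subprobability kernels.\<close>

definition mixture :: "'b measure \<Rightarrow> 'c measure \<Rightarrow> ('b \<Rightarrow> 'c measure) \<Rightarrow> 'c measure" where
  "mixture M K \<kappa> = measure_of (space K) (sets K) (\<lambda>A. \<integral>\<^sup>+x. emeasure (\<kappa> x) A \<partial>M)"

lemma space_mixture [simp]: "space (mixture M K \<kappa>) = space K"
  by (simp add: mixture_def space_measure_of_conv)

lemma sets_mixture [simp, measurable_cong]: "sets (mixture M K \<kappa>) = sets K"
  by (simp add: mixture_def)

lemma emeasure_mixture:
  assumes \<kappa>: "\<And>x. x \<in> space M \<Longrightarrow> sets (\<kappa> x) = sets K"
    and meas: "\<And>A. A \<in> sets K \<Longrightarrow> (\<lambda>x. emeasure (\<kappa> x) A) \<in> borel_measurable M"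
    and A: "A \<in> sets K"
  shows "emeasure (mixture M K \<kappa>) A = (\<integral>\<^sup>+x. emeasure (\<kappa> x) A \<partial>M)"
proof (rule emeasure_measure_of[OF mixture_def])
  show "countably_additive (sets (mixture M K \<kappa>)) (\<lambda>A. \<integral>\<^sup>+x. emeasure (\<kappa> x) A \<partial>M)"
  proof (rule countably_additiveI)
    fix B :: "nat \<Rightarrow> _"
    assume B: "range B \<subseteq> sets (mixture M K \<kappa>)" "disjoint_family B"
    have "(\<Sum>i. \<integral>\<^sup>+x. emeasure (\<kappa> x) (B i) \<partial>M) = (\<integral>\<^sup>+x. (\<Sum>i. emeasure (\<kappa> x) (B i)) \<partial>M)"
      using B by (intro nn_integral_suminf[symmetric] meas) auto
    also have "\<dots> = (\<integral>\<^sup>+x. emeasure (\<kappa> x) (\<Union>i. B i) \<partial>M)"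
      using B \<kappa> by (intro nn_integral_cong suminf_emeasure) auto
    finally show "(\<Sum>i. \<integral>\<^sup>+x. emeasure (\<kappa> x) (B i) \<partial>M) =
        (\<integral>\<^sup>+x. emeasure (\<kappa> x) (\<Union>i. B i) \<partial>M)" .
  qed
qed (use A sets.sets_into_space in \<open>auto simp: positive_def\<close>)

lemma nn_integral_mixture:
  assumes \<kappa>: "\<And>x. x \<in> space M \<Longrightarrow> sets (\<kappa> x) = sets K"
    and meas: "\<And>A. A \<in> sets K \<Longrightarrow> (\<lambda>x. emeasure (\<kappa> x) A) \<in> borel_measurable M"
    and g: "g \<in> borel_measurable K"
  shows "(\<integral>\<^sup>+y. g y \<partial>mixture M K \<kappa>) = (\<integral>\<^sup>+x. \<integral>\<^sup>+y. g y \<partial>\<kappa> x \<partial>M)"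
    (is "?L g = ?R g")
proof -
  have *: "f \<in> borel_measurable (\<kappa> x)" if "f \<in> borel_measurable K" "x \<in> space M"
    for f :: "'b \<Rightarrow> ennreal" and x
    using that \<kappa> measurable_cong_sets by blast
  have mix: "f \<in> borel_measurable (mixture M K \<kappa>)" if "f \<in> borel_measurable K"
    for f :: "'b \<Rightarrow> ennreal"
    using that by simp
  have sp: "space (\<kappa> x) = space K" if "x \<in> space M" for x
    using \<kappa>[OF that] by (rule sets_eq_imp_space_eq)
  have transfer: "(\<lambda>x. \<integral>\<^sup>+y. f y \<partial>\<kappa> x) \<in> borel_measurable M \<and> ?L f = ?R f"
    if "\<And>x. x \<in> space M \<Longrightarrow> (\<integral>\<^sup>+y. f y \<partial>\<kappa> x) = h x"
      and "h \<in> borel_measurable M" and "?L f = (\<integral>\<^sup>+x. h x \<partial>M)" for f h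
  proof
    show "(\<lambda>x. \<integral>\<^sup>+y. f y \<partial>\<kappa> x) \<in> borel_measurable M"
      using measurable_cong[THEN iffD2, OF that(1,2)] by blast
    have "?R f = (\<integral>\<^sup>+x. h x \<partial>M)"
      by (rule nn_integral_cong) (rule that(1))
    with that(3) show "?L f = ?R f" by (simp only:)
  qed
  have "(\<lambda>x. \<integral>\<^sup>+y. g y \<partial>\<kappa> x) \<in> borel_measurable M \<and> ?L g = ?R g"
    using g
  proof (induction g rule: borel_measurable_induct)
    case (cong f g)
    show ?case
    proof (rule transfer)
      fix x assume "x \<in> space M"
      then show "(\<integral>\<^sup>+y. f y \<partial>\<kappa> x) = (\<integral>\<^sup>+y. g y \<partial>\<kappa> x)"
        using cong(3) sp by (intro nn_integral_cong) auto
    next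
      have "?L f = ?L g"
        using cong(3) by (intro nn_integral_cong) auto
      with cong(4) show "?L f = ?R g" by (simp only:)
    qed (use cong(4) in blast)
  next
    case (set A)
    show ?case
    proof (rule transfer)
      fix x assume "x \<in> space M"
      with set \<kappa> show "(\<integral>\<^sup>+y. indicator A y \<partial>\<kappa> x) = emeasure (\<kappa> x) A"
        by simp
    next
      show "?L (indicator A) = (\<integral>\<^sup>+x. emeasure (\<kappa> x) A \<partial>M)"
        using set emeasure_mixture[OF \<kappa> meas set] by simp
    qed (rule meas[OF set])
  next
    case (mult u c)
    show ?case
    proof (rule transfer)
      fix x assume "x \<in> space M"
      show "(\<integral>\<^sup>+y. c * u y \<partial>\<kappa> x) = c * (\<integral>\<^sup>+y. u y \<partial>\<kappa> x)"
        by (rule nn_integral_cmult[OF *[OF mult(2) \<open>x \<in> space M\<close>]])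
    next
      show "(\<lambda>x. c * (\<integral>\<^sup>+y. u y \<partial>\<kappa> x)) \<in> borel_measurable M"
        using mult(4) by (intro borel_measurable_times_ennreal) auto
      have "?L (\<lambda>y. c * u y) = c * ?L u"
        by (rule nn_integral_cmult[OF mix[OF mult(2)]])
      also have "\<dots> = c * ?R u"
        using mult(4) by (simp only:)
      also have "\<dots> = (\<integral>\<^sup>+x. c * (\<integral>\<^sup>+y. u y \<partial>\<kappa> x) \<partial>M)"
        by (rule nn_integral_cmult[symmetric]) (use mult(4) in blast)
      finally show "?L (\<lambda>y. c * u y) = (\<integral>\<^sup>+x. c * (\<integral>\<^sup>+y. u y \<partial>\<kappa> x) \<partial>M)" .
    qed
  next
    case (add u v)
    show ?case
    proof (rule transfer)
      fix x assume "x \<in> space M"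
      show "(\<integral>\<^sup>+y. v y + u y \<partial>\<kappa> x) = (\<integral>\<^sup>+y. v y \<partial>\<kappa> x) + (\<integral>\<^sup>+y. u y \<partial>\<kappa> x)"
        by (rule nn_integral_add[OF *[OF add(3) \<open>x \<in> space M\<close>] *[OF add(1) \<open>x \<in> space M\<close>]])
    next
      show "(\<lambda>x. (\<integral>\<^sup>+y. v y \<partial>\<kappa> x) + (\<integral>\<^sup>+y. u y \<partial>\<kappa> x)) \<in> borel_measurable M"
        using add.IH by (intro borel_measurable_add) auto
      have "?L (\<lambda>y. v y + u y) = ?L v + ?L u"
        by (rule nn_integral_add[OF mix[OF add(3)] mix[OF add(1)]])
      also have "\<dots> = ?R v + ?R u"
        using add.IH by (simp only:)
      also have "\<dots> = (\<integral>\<^sup>+x. (\<integral>\<^sup>+y. v y \<partial>\<kappa> x) + (\<integral>\<^sup>+y. u y \<partial>\<kappa> x) \<partial>M)"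
        by (rule nn_integral_add[symmetric]) (use add.IH in blast)+
      finally show "?L (\<lambda>y. v y + u y) = (\<integral>\<^sup>+x. (\<integral>\<^sup>+y. v y \<partial>\<kappa> x) + (\<integral>\<^sup>+y. u y \<partial>\<kappa> x) \<partial>M)" .
    qed
  next
    case (seq U)
    have mono: "incseq (\<lambda>i x. \<integral>\<^sup>+y. U i y \<partial>\<kappa> x)"
      using seq(3) by (auto simp: incseq_def le_fun_def intro!: nn_integral_mono)
    show ?case
    proof (rule transfer)
      fix x assume "x \<in> space M"
      show "(\<integral>\<^sup>+y. (SUP i. U i) y \<partial>\<kappa> x) = (SUP i. \<integral>\<^sup>+y. U i y \<partial>\<kappa> x)"
        unfolding SUP_apply
        by (rule nn_integral_monotone_convergence_SUP[OF seq(3) *[OF seq(1) \<open>x \<in> space M\<close>]])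
    next
      show "(\<lambda>x. SUP i. \<integral>\<^sup>+y. U i y \<partial>\<kappa> x) \<in> borel_measurable M"
        using seq.IH by (intro borel_measurable_SUP) auto
      have "?L (SUP i. U i) = (SUP i. ?L (U i))"
        unfolding SUP_apply
        by (rule nn_integral_monotone_convergence_SUP[OF seq(3) mix[OF seq(1)]])
      also have "\<dots> = (SUP i. ?R (U i))"
        using seq.IH by (simp only:)
      also have "\<dots> = (\<integral>\<^sup>+x. (SUP i. \<integral>\<^sup>+y. U i y \<partial>\<kappa> x) \<partial>M)"
        by (rule nn_integral_monotone_convergence_SUP[OF mono, symmetric]) (use seq.IH in blast)
      finally show "?L (SUP i. U i) = (\<integral>\<^sup>+x. (SUP i. \<integral>\<^sup>+y. U i y \<partial>\<kappa> x) \<partial>M)" .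
    qed
  qed
  then show ?thesis ..
qed

definition moment_measure :: "nat \<Rightarrow> 'a::polish_space measure measure \<Rightarrow> (nat \<Rightarrow> 'a) measure" where
  "moment_measure n P = mixture P (\<Pi>\<^sub>M i\<in>{1..n}. borel) (\<lambda>N. \<Pi>\<^sub>M i\<in>{1..n}. N)"


section \<open>The measure of products over distinct values\<close>

text \<open>For a partition \<open>p\<close> the distinct values are indexed by the cells of \<open>p\<close> themselves;
  \<open>expand p w\<close> is the vector all of whose coordinates in the cell \<open>C\<close> are equal to \<open>w C\<close>.
  The integral against \<open>tie_measure\<close> is given in \<open>nn_integral_tie_measure\<close> below.\<close>

definition cell_of :: "nat set set \<Rightarrow> nat \<Rightarrow> nat set" where
  "cell_of p i = (THE C. C \<in> p \<and> i \<in> C)"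

definition expand :: "nat \<Rightarrow> nat set set \<Rightarrow> (nat set \<Rightarrow> 'a) \<Rightarrow> (nat \<Rightarrow> 'a)" where
  "expand n p w = (\<lambda>i\<in>{1..n}. w (cell_of p i))"

definition tie_measure :: "nat \<Rightarrow> 'a::polish_space measure \<Rightarrow> (nat \<Rightarrow> 'a) measure" where
  "tie_measure n \<nu> =
     mixture (count_space {p. partition_on {1..n} p}) (\<Pi>\<^sub>M i\<in>{1..n}. borel)
       (\<lambda>p. distr (\<Pi>\<^sub>M C\<in>p. \<nu>) (\<Pi>\<^sub>M i\<in>{1..n}. borel) (expand n p))"

lemma cell_of_in:
  assumes "partition_on A p" "i \<in> A"
  shows "cell_of p i \<in> p"
proof -
  have "\<exists>!C. C \<in> p \<and> i \<in> C"
    using assms partition_onD1[OF assms(1)] partition_onD2[OF assms(1)]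
    by (auto simp: disjoint_def)
  from theI'[OF this] show ?thesis
    by (simp add: cell_of_def)
qed

lemma measurable_expand:
  assumes "partition_on {1..n} p" "sets \<nu> = sets borel"
  shows "expand n p \<in> measurable (\<Pi>\<^sub>M C\<in>p. \<nu>) (\<Pi>\<^sub>M i\<in>{1..n}. borel)"
  unfolding expand_def
proof (rule measurable_restrict)
  fix i assume "i \<in> {1..n}"
  then have "(\<lambda>w. w (cell_of p i)) \<in> measurable (\<Pi>\<^sub>M C\<in>p. \<nu>) \<nu>"
    using cell_of_in[OF assms(1)] by (intro measurable_component_singleton) auto
  then show "(\<lambda>w. w (cell_of p i)) \<in> measurable (\<Pi>\<^sub>M C\<in>p. \<nu>) borel"
    using assms(2) measurable_cong_sets by blast
qed

lemma nn_integral_tie_measure: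
  assumes \<nu>: "sets \<nu> = sets borel"
    and g: "g \<in> borel_measurable (\<Pi>\<^sub>M i\<in>{1..n}. borel)"
  shows "(\<integral>\<^sup>+W. g W \<partial>tie_measure n \<nu>) =
    (\<Sum>p\<in>{p. partition_on {1..n} p}. \<integral>\<^sup>+w. g (expand n p w) \<partial>(\<Pi>\<^sub>M C\<in>p. \<nu>))"
proof -
  have fin: "finite {p. partition_on {1..n} p}"
    by (rule finitely_many_partition_on) simp
  have "(\<integral>\<^sup>+W. g W \<partial>tie_measure n \<nu>) = (\<integral>\<^sup>+p. \<integral>\<^sup>+W. g W \<partial>distr (\<Pi>\<^sub>M C\<in>p. \<nu>)
      (\<Pi>\<^sub>M i\<in>{1..n}. borel) (expand n p) \<partial>count_space {p. partition_on {1..n} p})"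
    unfolding tie_measure_def by (rule nn_integral_mixture[OF _ _ g]) auto
  also have "\<dots> = (\<Sum>p\<in>{p. partition_on {1..n} p}. \<integral>\<^sup>+W. g W \<partial>distr (\<Pi>\<^sub>M C\<in>p. \<nu>)
      (\<Pi>\<^sub>M i\<in>{1..n}. borel) (expand n p))"
    using fin by (rule nn_integral_count_space_finite)
  also have "\<dots> = (\<Sum>p\<in>{p. partition_on {1..n} p}. \<integral>\<^sup>+w. g (expand n p w) \<partial>(\<Pi>\<^sub>M C\<in>p. \<nu>))"
    using \<nu> g by (intro sum.cong refl nn_integral_distr measurable_expand) auto
  finally show ?thesis .
qed

text \<open>The product of the successive conditional moment measures. The step from \<open>m\<close> to \<open>Suc m\<close> draws
  the coordinate \<open>Suc m\<close> from \<open>\<nu>\<close> plus unit masses at the distinct values of the first \<open>m\<close>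
  coordinates; the first factor is \<open>\<nu>\<close>, since there are no earlier values.\<close>

fun sequential_measure :: "nat \<Rightarrow> 'a::polish_space measure \<Rightarrow> (nat \<Rightarrow> 'a) measure" where
  "sequential_measure 0 \<nu> = (\<Pi>\<^sub>M i\<in>{}. borel)"
| "sequential_measure (Suc m) \<nu> =
     mixture (sequential_measure m \<nu>) (\<Pi>\<^sub>M i\<in>{1..Suc m}. borel)
       (\<lambda>W. distr (add_dirac \<nu> (W ` {1..m})) (\<Pi>\<^sub>M i\<in>{1..Suc m}. borel) (\<lambda>x. W(Suc m := x)))"

end

theory Submission
  imports Defs
begin

text \<open>The functions \<open>N \<mapsto> exp (- N f)\<close>, with \<open>f\<close> simple and of bounded support, are closed under products
  and generate the sigma-field of \<^const>\<open>bfm\<close>, so by Weierstrass approximation they determine a finite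
  measure on it. Applied to \<open>D \<mapsto> E [N(B); N \<in> D]\<close> and \<open>D \<mapsto> \<integral>\<^sub>B P (N + \<delta>\<^sub>x \<in> D) \<nu>(dx)\<close>, this reduces
  Mecke's formula (the case \<open>n = 1\<close>) to \<open>E [N(B) exp (- N f)] = (\<integral>\<^sub>B exp (- f) d\<nu>) E [exp (- N f)]\<close>, which
  by independence over the level sets of \<open>f\<close> is the identity
  \<open>E [K exp (- r K)] = \<lambda> exp (- r) E [exp (- r K)]\<close> for a Poisson variable \<open>K\<close> of mean \<open>\<lambda>\<close>. Iterating
  Mecke's formula integrates the \<open>i\<close>-th coordinate against \<open>\<nu>\<close> plus unit masses at the earlier values,
  which is the sequential form of the moment measure. In terms of partitions of ties, each step adds
  a cell or enlarges one, and distinct cells almost surely carry distinct values because \<open>\<nu>\<close> is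
  nonatomic.\<close>

section \<open>Kernels of boundedly finite measures\<close>

text \<open>Two features shape the argument. Both \<open>N\<close> and \<open>\<nu>\<close> may have
  infinite total mass, so whatever subtracts masses or compares finite measures is done on a bounded
  set, and balls of integer radius then exhaust the space. And \<open>poisson_law\<close> speaks
  only of the counts of finitely many disjoint bounded sets. This is why the test functions are
  simple: for them \<open>N f\<close> is a finite combination of such counts. The set
  \<open>B\<close> in the weight \<open>N(B)\<close> is unrelated to the levels of \<open>f\<close>,
  so it is cut along them; on each piece \<open>f\<close> is constant, and the count of the piece is
  independent of what \<open>f\<close> collects elsewhere. Nonatomicity enters at two points, both
  because \<open>add_dirac\<close> charges a set of values, each of them once. The fresh point
  supplied by Mecke's formula has to avoid the values already present, and the values attached to
  different cells have to differ, so that a sum over cells is a sum over distinct values.\<close>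

declare One_nat_def [simp del]

lemma bfm_setD:
  assumes "N \<in> bfm_set"
  shows sets_bfm_set: "sets N = sets borel" and space_bfm_set: "space N = UNIV"
proof -
  show "sets N = sets borel"
    using assms by (simp add: bfm_set_def)
  then show "space N = UNIV"
    using sets_eq_imp_space_eq by fastforce
qed

lemma emeasure_bfm_bounded:
  "N \<in> bfm_set \<Longrightarrow> A \<in> sets borel \<Longrightarrow> bounded A \<Longrightarrow> emeasure N A < \<infinity>"
  by (auto simp: bfm_set_def)

lemma UN_ball_nat: "(\<Union>n::nat. ball (x::'a::metric_space) (real n)) = UNIV"
  by (auto intro: reals_Archimedean2)

lemma incseq_ball_nat: "incseq (\<lambda>n::nat. ball (x::'a::metric_space) (real n))"
  by (auto simp: incseq_def)

lemma sigma_finite_bfm: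
  assumes "N \<in> bfm_set"
  shows "sigma_finite_measure N"
proof
  let ?A = "range (\<lambda>n::nat. ball (undefined::'a) (real n))"
  show "\<exists>A. countable A \<and> A \<subseteq> sets N \<and> \<Union>A = space N \<and> (\<forall>a\<in>A. emeasure N a \<noteq> \<infinity>)"
    using assms emeasure_bfm_bounded[OF assms] UN_ball_nat
    by (intro exI[of _ ?A]) (auto simp: bfm_setD[OF assms] less_top[symmetric])
qed

lemma product_sigma_finite_bfm:
  assumes "N \<in> bfm_set"
  shows "product_sigma_finite (\<lambda>_. N)"
  using sigma_finite_bfm[OF assms] by (simp add: product_sigma_finite_def)

lemma emeasure_SUP_ball:
  assumes "N \<in> bfm_set" "A \<in> sets borel"
  shows "emeasure N A = (SUP n::nat. emeasure N (A \<inter> ball x (real n)))"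
proof -
  have "(SUP n::nat. emeasure N (A \<inter> ball x (real n))) = emeasure N (\<Union>n::nat. A \<inter> ball x (real n))"
    using assms incseq_ball_nat[of x]
    by (intro SUP_emeasure_incseq) (auto simp: incseq_def bfm_setD)
  also have "(\<Union>n::nat. A \<inter> ball x (real n)) = A"
    using UN_ball_nat[of x] by blast
  finally show ?thesis ..
qed

text \<open>Masses of bounded sets are finite and can therefore be recovered by a logarithm from
  their Laplace factors. \<open>finite_measure_bfm_eqI_laplace\<close> relies on a criterion that
  asks for these masses alone.\<close>

lemma measurable_bfmI_bounded:
  assumes f: "\<And>x. x \<in> space M \<Longrightarrow> f x \<in> bfm_set"
    and meas: "\<And>A. A \<in> sets borel \<Longrightarrow> bounded A \<Longrightarrow> (\<lambda>x. emeasure (f x) A) \<in> borel_measurable M"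
  shows "f \<in> measurable M bfm"
proof (rule measurable_bfmI[OF f])
  fix A :: "'b set" assume A: "A \<in> sets borel"
  have "(\<lambda>x. SUP n::nat. emeasure (f x) (A \<inter> ball undefined (real n))) \<in> borel_measurable M"
    using A by (intro borel_measurable_SUP meas) (auto intro: bounded_subset[OF bounded_ball])
  then show "(\<lambda>x. emeasure (f x) A) \<in> borel_measurable M"
    using emeasure_SUP_ball[OF f A] by (subst measurable_cong) auto
qed

text \<open>Intersecting with a bounded set makes all masses finite. The complement step of the
  Dynkin argument depends on this, since it obtains the mass of a complement by subtraction.\<close>

lemma measurable_slice_bounded:
  assumes K: "K \<in> measurable M bfm"
    and A: "A \<in> sets (M \<Otimes>\<^sub>M borel)" and B: "B \<in> sets borel" "bounded B"
  shows "(\<lambda>x. emeasure (K x) (Pair x -` A \<inter> B)) \<in> borel_measurable M"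
proof -
  have Kx: "K x \<in> bfm_set" if "x \<in> space M" for x
    using measurable_space[OF K that] by simp
  note [measurable] = K B(1)
  have cut: "Pair x -` C \<in> sets borel" if "C \<in> sets (M \<Otimes>\<^sub>M (borel::'b measure))" for C x
    using sets_Pair1[OF that] by simp
  have "Int_stable {a \<times> b | a b. a \<in> sets M \<and> b \<in> sets (borel::'b measure)}"
    by (rule Int_stable_pair_measure_generator)
  moreover have "{a \<times> b | a b. a \<in> sets M \<and> b \<in> sets (borel::'b measure)} \<subseteq> Pow (space M \<times> UNIV)"
    using sets.sets_into_space by fastforce
  moreover have "A \<in> sigma_sets (space M \<times> UNIV)
      {a \<times> b | a b. a \<in> sets M \<and> b \<in> sets (borel::'b measure)}"
    using A by (simp add: sets_pair_measure)
  ultimately show ?thesis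
  proof (induction rule: sigma_sets_induct_disjoint)
    case (basic C)
    then obtain a b where C: "C = a \<times> b" and [measurable]: "a \<in> sets M" "b \<in> sets borel"
      by auto
    have "(\<lambda>x. emeasure (K x) (b \<inter> B) * indicator a x) \<in> borel_measurable M"
      using measurable_compose[OF K measurable_emeasure_bfm[of "b \<inter> B"]] by measurable
    then show ?case
      by (subst measurable_cong[where g = "\<lambda>x. emeasure (K x) (b \<inter> B) * indicator a x"])
         (auto simp: C indicator_def vimage_def Int_def)
  next
    case empty
    then show ?case by simp
  next
    case (compl C)
    have C: "C \<in> sets (M \<Otimes>\<^sub>M (borel::'b measure))"
      using compl by (simp add: sets_pair_measure)
    have "(\<lambda>x. emeasure (K x) B - emeasure (K x) (Pair x -` C \<inter> B)) \<in> borel_measurable M"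
      using measurable_compose[OF K measurable_emeasure_bfm[of B]] compl(2) by measurable
    moreover have "emeasure (K x) (Pair x -` (space M \<times> UNIV - C) \<inter> B) =
        emeasure (K x) B - emeasure (K x) (Pair x -` C \<inter> B)" if x: "x \<in> space M" for x
    proof -
      have "Pair x -` (space M \<times> UNIV - C) \<inter> B = B - Pair x -` C \<inter> B"
        using x by auto
      also have "emeasure (K x) \<dots> = emeasure (K x) B - emeasure (K x) (Pair x -` C \<inter> B)"
      proof (rule emeasure_Diff)
        have "emeasure (K x) (Pair x -` C \<inter> B) \<le> emeasure (K x) B"
          using B by (intro emeasure_mono) (auto simp: bfm_setD[OF Kx[OF x]])
        also have "\<dots> < \<infinity>"
          by (rule emeasure_bfm_bounded[OF Kx[OF x] B])
        finally show "emeasure (K x) (Pair x -` C \<inter> B) \<noteq> \<infinity>" by simp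
      qed (use B cut[OF C] in \<open>auto simp: bfm_setD[OF Kx[OF x]]\<close>)
      finally show ?thesis .
    qed
    ultimately show ?case
      by (subst measurable_cong) auto
  next
    case (union F)
    have F: "F i \<in> sets (M \<Otimes>\<^sub>M (borel::'b measure))" for i
      using union(2) by (auto simp: sets_pair_measure)
    have "(\<lambda>x. \<Sum>i. emeasure (K x) (Pair x -` F i \<inter> B)) \<in> borel_measurable M"
      by (intro borel_measurable_suminf_order union(3))
    moreover have "emeasure (K x) (Pair x -` (\<Union>i. F i) \<inter> B) =
        (\<Sum>i. emeasure (K x) (Pair x -` F i \<inter> B))" if x: "x \<in> space M" for x
    proof -
      have "(\<Sum>i. emeasure (K x) (Pair x -` F i \<inter> B)) = emeasure (K x) (\<Union>i. Pair x -` F i \<inter> B)"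
        using union(1) cut[OF F] B
        by (intro suminf_emeasure) (auto simp: bfm_setD[OF Kx[OF x]] disjoint_family_on_def)
      also have "(\<Union>i. Pair x -` F i \<inter> B) = Pair x -` (\<Union>i. F i) \<inter> B" by auto
      finally show ?thesis ..
    qed
    ultimately show ?case
      by (subst measurable_cong) auto
  qed
qed

lemma measurable_slice:
  assumes K: "K \<in> measurable M bfm" and A: "A \<in> sets (M \<Otimes>\<^sub>M borel)"
  shows "(\<lambda>x. emeasure (K x) (Pair x -` A)) \<in> borel_measurable M"
proof -
  have "(\<lambda>x. SUP n::nat. emeasure (K x) (Pair x -` A \<inter> ball undefined (real n))) \<in> borel_measurable M"
    using K A by (intro borel_measurable_SUP measurable_slice_bounded) auto
  moreover have "emeasure (K x) (Pair x -` A) =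
      (SUP n::nat. emeasure (K x) (Pair x -` A \<inter> ball undefined (real n)))" if "x \<in> space M" for x
    using measurable_space[OF K that] sets_Pair1[OF A] by (intro emeasure_SUP_ball) auto
  ultimately show ?thesis
    by (subst measurable_cong) auto
qed

lemma measurable_nn_integral_kernel:
  fixes g :: "'b \<times> 'a::polish_space \<Rightarrow> ennreal"
  assumes K: "K \<in> measurable M bfm" and g: "g \<in> borel_measurable (M \<Otimes>\<^sub>M borel)"
  shows "(\<lambda>x. \<integral>\<^sup>+y. g (x, y) \<partial>K x) \<in> borel_measurable M"
proof -
  have sets: "sets (K x) = sets borel" if "x \<in> space M" for x
    using measurable_space[OF K that] by (simp add: sets_bfm_set)
  have slice: "(\<lambda>y. f (x, y)) \<in> borel_measurable (K x)"
    if "f \<in> borel_measurable (M \<Otimes>\<^sub>M (borel::'a measure))" "x \<in> space M"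
    for f :: "'b \<times> 'a \<Rightarrow> ennreal" and x
    using that measurable_compose[OF measurable_Pair1'[OF that(2)] that(1)]
      sets[OF that(2)] measurable_cong_sets by blast
  show ?thesis
    using g
  proof (induction g rule: borel_measurable_induct)
    case (cong f g)
    have "(\<integral>\<^sup>+y. f (x, y) \<partial>K x) = (\<integral>\<^sup>+y. g (x, y) \<partial>K x)" if "x \<in> space M" for x
      using cong(3) that by (intro nn_integral_cong) (auto simp: space_pair_measure)
    then show ?case
      using cong(4) by (subst measurable_cong) auto
  next
    case (set A)
    have "(\<integral>\<^sup>+y. indicator A (x, y) \<partial>K x) = emeasure (K x) (Pair x -` A)" if "x \<in> space M" for x
    proof -
      have "(\<integral>\<^sup>+y. indicator A (x, y) \<partial>K x) = (\<integral>\<^sup>+y. indicator (Pair x -` A) y \<partial>K x)"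
        by (intro nn_integral_cong) (auto simp: indicator_def)
      also have "\<dots> = emeasure (K x) (Pair x -` A)"
        using sets[OF that] sets_Pair1[OF set] by (intro nn_integral_indicator) auto
      finally show ?thesis .
    qed
    then show ?case
      using measurable_slice[OF K set] by (subst measurable_cong) auto
  next
    case (mult u c)
    have eq: "(\<integral>\<^sup>+y. c * u (x, y) \<partial>K x) = c * (\<integral>\<^sup>+y. u (x, y) \<partial>K x)" if "x \<in> space M" for x
      by (rule nn_integral_cmult[OF slice[OF mult(2) that]])
    show ?case
      by (rule measurable_cong[THEN iffD2, OF eq]) (use mult(4) in simp_all)
  next
    case (add u v)
    have eq: "(\<integral>\<^sup>+y. v (x, y) + u (x, y) \<partial>K x) = (\<integral>\<^sup>+y. v (x, y) \<partial>K x) + (\<integral>\<^sup>+y. u (x, y) \<partial>K x)"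
      if "x \<in> space M" for x
      by (rule nn_integral_add[OF slice[OF add(3) that] slice[OF add(1) that]])
    show ?case
      by (rule measurable_cong[THEN iffD2, OF eq]) (use add.IH in simp_all)
  next
    case (seq U)
    have eq: "(\<integral>\<^sup>+y. (SUP i. U i) (x, y) \<partial>K x) = (SUP i. \<integral>\<^sup>+y. U i (x, y) \<partial>K x)" if "x \<in> space M" for x
      unfolding SUP_apply using seq(3)
      by (intro nn_integral_monotone_convergence_SUP slice[OF seq(1) that])
         (auto simp: incseq_def le_fun_def)
    show ?case
      by (rule measurable_cong[THEN iffD2, OF eq]) (use seq.IH in \<open>auto intro!: borel_measurable_SUP\<close>)
  qed
qed

section \<open>Finite powers of a boundedly finite measure\<close>

lemma sets_PiM_bfm_set:
  "N \<in> bfm_set \<Longrightarrow> sets (\<Pi>\<^sub>M i\<in>I. N) = sets (\<Pi>\<^sub>M i\<in>I. borel)"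
  by (intro sets_PiM_cong) (auto simp: sets_bfm_set)

text \<open>The last coordinate is made the inner variable because, in the recursions below, its law
  depends on the first \<open>m\<close> coordinates.\<close>

lemma nn_integral_PiM_Suc:
  assumes N: "N \<in> bfm_set" and g: "g \<in> borel_measurable (\<Pi>\<^sub>M i\<in>{1..Suc m}. borel)"
  shows "(\<integral>\<^sup>+W. g W \<partial>(\<Pi>\<^sub>M i\<in>{1..Suc m}. N)) =
    (\<integral>\<^sup>+W. \<integral>\<^sup>+x. g (W(Suc m := x)) \<partial>N \<partial>(\<Pi>\<^sub>M i\<in>{1..m}. N))"
proof -
  interpret product_sigma_finite "\<lambda>_. N"
    by (rule product_sigma_finite_bfm[OF N])
  have "g \<in> borel_measurable (\<Pi>\<^sub>M i\<in>insert (Suc m) {1..m}. N)"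
    using g unfolding measurable_cong_sets[OF sets_PiM_bfm_set[OF N] refl] atLeastAtMostSuc_conv
    by (simp add: atLeastAtMostSuc_conv)
  from product_nn_integral_insert[OF _ _ this] show ?thesis
    by (simp add: atLeastAtMostSuc_conv)
qed

lemma measurable_fun_upd_Suc [measurable]:
  "(\<lambda>(W, x). W(Suc m := x)) \<in> measurable ((\<Pi>\<^sub>M i\<in>{1..m}. borel) \<Otimes>\<^sub>M borel) (\<Pi>\<^sub>M i\<in>{1..Suc m}. borel)"
  using measurable_add_dim[of "Suc m" "{1..m}" "\<lambda>_. borel"]
  by (simp add: atLeastAtMostSuc_conv case_prod_beta)

lemma measurable_nn_integral_power:
  fixes g :: "'b \<times> (nat \<Rightarrow> 'a::polish_space) \<Rightarrow> ennreal"
  assumes K: "K \<in> measurable M bfm" and g: "g \<in> borel_measurable (M \<Otimes>\<^sub>M (\<Pi>\<^sub>M i\<in>{1..n}. borel))"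
  shows "(\<lambda>x. \<integral>\<^sup>+W. g (x, W) \<partial>(\<Pi>\<^sub>M i\<in>{1..n}. K x)) \<in> borel_measurable M"
  using g
proof (induction n arbitrary: g)
  case 0
  \<comment> \<open>The product space over the empty index set has the single point
    \<open>\<lambda>_. undefined\<close>, and the product measure is the unit mass there.\<close>
  have "(\<lambda>x. g (x, \<lambda>_. undefined)) \<in> borel_measurable M"
    using 0 by (rule measurable_compose[rotated]) (auto simp: space_PiM)
  then show ?case
    by (simp add: PiM_empty nn_integral_count_space_finite)
next
  case (Suc m)
  note [measurable] = Suc.prems K
  \<comment> \<open>To integrate out the last coordinate, the parameter together with the first
    \<open>m\<close> coordinates is treated as the parameter of the kernel \<open>K (fst z)\<close>.
    The induction hypothesis then deals with the remaining coordinates.\<close>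
  define h where "h = (\<lambda>z. \<integral>\<^sup>+y. g (fst z, (snd z)(Suc m := y)) \<partial>K (fst z))"
  have "(\<lambda>z. g (fst (fst z), (snd (fst z))(Suc m := snd z)))
      \<in> borel_measurable ((M \<Otimes>\<^sub>M (\<Pi>\<^sub>M i\<in>{1..m}. borel)) \<Otimes>\<^sub>M borel)"
  proof (rule measurable_compose[OF measurable_Pair Suc.prems])
    show "(\<lambda>z. (snd (fst z))(Suc m := snd z)) \<in> measurable
      ((M \<Otimes>\<^sub>M (\<Pi>\<^sub>M i\<in>{1..m}. borel)) \<Otimes>\<^sub>M (borel :: 'a measure)) (\<Pi>\<^sub>M i\<in>{1..Suc m}. borel)"
    proof -
      have "(\<lambda>z. (snd (fst z), snd z)) \<in> measurable ((M \<Otimes>\<^sub>M (\<Pi>\<^sub>M i\<in>{1..m}. borel)) \<Otimes>\<^sub>M borel)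
          ((\<Pi>\<^sub>M i\<in>{1..m}. borel) \<Otimes>\<^sub>M (borel :: 'a measure))"
        by measurable
      from measurable_compose[OF this measurable_fun_upd_Suc] show ?thesis by simp
    qed
  qed simp
  then have "h \<in> borel_measurable (M \<Otimes>\<^sub>M (\<Pi>\<^sub>M i\<in>{1..m}. borel))"
    unfolding h_def
    using measurable_nn_integral_kernel[where K = "\<lambda>z. K (fst z)" and M = "M \<Otimes>\<^sub>M (\<Pi>\<^sub>M i\<in>{1..m}. borel)"
        and g = "\<lambda>z. g (fst (fst z), (snd (fst z))(Suc m := snd z))"]
    by simp
  from Suc.IH[OF this] show ?case
  proof (rule measurable_cong[THEN iffD1, rotated])
    fix x assume x: "x \<in> space M"
    have "K x \<in> bfm_set"
      using measurable_space[OF K x] by simp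
    moreover have "(\<lambda>W. g (x, W)) \<in> borel_measurable (\<Pi>\<^sub>M i\<in>{1..Suc m}. borel)"
      using x by measurable
    ultimately show "(\<integral>\<^sup>+W. h (x, W) \<partial>(\<Pi>\<^sub>M i\<in>{1..m}. K x)) =
        (\<integral>\<^sup>+W. g (x, W) \<partial>(\<Pi>\<^sub>M i\<in>{1..Suc m}. K x))"
      by (simp add: nn_integral_PiM_Suc h_def)
  qed
qed

section \<open>Unit masses at the values of a vector\<close>

lemma image_fun_upd_Suc: "(W(Suc m := x)) ` {1..Suc m} = insert x (W ` {1..m})"
  by (auto simp: atLeastAtMostSuc_conv)

text \<open>The number of distinct values varies with \<open>W\<close>, so this is not a fixed sum
  over coordinates. It is built up one coordinate at a time: the next coordinate contributes only
  where it differs from all earlier ones, and this event is measurable because diagonals are.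
  Separating \<open>m\<close> from \<open>n\<close> keeps the space of vectors fixed during the
  induction.\<close>

lemma measurable_sum_image:
  fixes A :: "'a::polish_space set" and m n :: nat
  assumes A: "A \<in> sets borel" and "m \<le> n"
  shows "(\<lambda>W. \<Sum>x\<in>W ` {1..m}. indicator A x :: ennreal) \<in> borel_measurable (\<Pi>\<^sub>M i\<in>{1..n}. borel)"
  using \<open>m \<le> n\<close>
proof (induction m)
  case (Suc m)
  note [measurable] = A
  have comp [measurable]: "(\<lambda>W. W i) \<in> borel_measurable (\<Pi>\<^sub>M i\<in>{1..n}. borel :: 'a measure)"
    if "i \<in> {1..n}" for i
    using that by (rule measurable_component_singleton)
  have [measurable]: "(\<lambda>W. \<Sum>x\<in>W ` {1..m}. indicator A x :: ennreal)
      \<in> borel_measurable (\<Pi>\<^sub>M i\<in>{1..n}. borel)"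
    using Suc by simp
  have [measurable]: "Measurable.pred (\<Pi>\<^sub>M i\<in>{1..n}. borel :: 'a measure) (\<lambda>W. \<exists>i\<in>{1..m}. W (Suc m) = W i)"
    unfolding pred_def using Suc.prems
    by (intro sets.sets_Collect_finite_Ex measurable_equality_set comp) auto
  have [measurable]: "(\<lambda>W. W (Suc m)) \<in> borel_measurable (\<Pi>\<^sub>M i\<in>{1..n}. borel :: 'a measure)"
    using Suc.prems by simp
  have "(\<Sum>x\<in>W ` {1..Suc m}. indicator A x :: ennreal) =
      (\<Sum>x\<in>W ` {1..m}. indicator A x) + (if \<exists>i\<in>{1..m}. W (Suc m) = W i then 0 else indicator A (W (Suc m)))"
    for W :: "nat \<Rightarrow> 'a"
    by (auto simp: atLeastAtMostSuc_conv sum.insert_if image_iff add.commute)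
  then show ?case by simp
qed simp

lemma measurable_add_dirac_pair [measurable]:
  fixes n :: nat
  shows "(\<lambda>(W, N). add_dirac N (W ` {1..n}))
    \<in> measurable ((\<Pi>\<^sub>M i\<in>{1..n}. borel :: 'a::polish_space measure) \<Otimes>\<^sub>M bfm) bfm"
proof (rule measurable_bfmI)
  fix A :: "'a set" assume A [measurable]: "A \<in> sets borel"
  have [measurable]: "(\<lambda>z. \<Sum>x\<in>fst z ` {1..n}. indicator A x :: ennreal)
      \<in> borel_measurable ((\<Pi>\<^sub>M i\<in>{1..n}. borel :: 'a measure) \<Otimes>\<^sub>M bfm)"
    by (rule measurable_compose[OF measurable_fst measurable_sum_image[OF A order_refl]])
  have "(\<lambda>z. emeasure (snd z) A + (\<Sum>x\<in>fst z ` {1..n}. indicator A x))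
      \<in> borel_measurable ((\<Pi>\<^sub>M i\<in>{1..n}. borel :: 'a measure) \<Otimes>\<^sub>M bfm)"
    using measurable_compose[OF measurable_snd measurable_emeasure_bfm[OF A]] by measurable
  then show "(\<lambda>z. emeasure (case z of (W, N) \<Rightarrow> add_dirac N (W ` {1..n})) A)
      \<in> borel_measurable ((\<Pi>\<^sub>M i\<in>{1..n}. borel :: 'a measure) \<Otimes>\<^sub>M bfm)"
    by (rule measurable_cong[THEN iffD1, rotated])
       (use A in \<open>auto simp: space_pair_measure emeasure_add_dirac bfm_setD\<close>)
qed (auto simp: space_pair_measure intro!: add_dirac_bfm)

lemma measurable_add_dirac_fixed:
  fixes N :: "'a::polish_space measure" and n :: nat
  assumes "N \<in> bfm_set"
  shows "(\<lambda>W. add_dirac N (W ` {1..n})) \<in> measurable (\<Pi>\<^sub>M i\<in>{1..n}. borel) bfm"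
proof -
  have "(\<lambda>W. (W, N)) \<in> measurable (\<Pi>\<^sub>M i\<in>{1..n}. borel :: 'a measure) ((\<Pi>\<^sub>M i\<in>{1..n}. borel) \<Otimes>\<^sub>M bfm)"
    using assms by auto
  from measurable_compose[OF this measurable_add_dirac_pair] show ?thesis
    by simp
qed

lemma nn_integral_add_dirac:
  fixes N :: "'a::polish_space measure" and g :: "'a \<Rightarrow> ennreal"
  assumes N: "N \<in> bfm_set" and S: "finite S" and g: "g \<in> borel_measurable borel"
  shows "(\<integral>\<^sup>+x. g x \<partial>add_dirac N S) = (\<integral>\<^sup>+x. g x \<partial>N) + (\<Sum>x\<in>S. g x)"
proof -
  have meas: "f \<in> borel_measurable N" "f \<in> borel_measurable (add_dirac N S)"
    if "f \<in> borel_measurable borel" for f :: "'a \<Rightarrow> ennreal"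
    using that by (simp_all add: measurable_cong_sets[OF sets_bfm_set[OF N] refl]
        measurable_cong_sets[OF sets_add_dirac refl])
  show ?thesis
    using g
  proof (induction g rule: borel_measurable_induct)
    case (cong f g)
    then have "f = g" by auto
    with cong show ?case by simp
  next
    case (set A)
    then show ?case
      using N by (simp add: emeasure_add_dirac bfm_setD)
  next
    case (mult u c)
    then show ?case
      by (simp add: nn_integral_cmult meas distrib_left sum_distrib_left)
  next
    case (add u v)
    then show ?case
      by (simp only: nn_integral_add meas sum.distrib add.assoc add.left_commute add.commute)
  next
    case (seq U)
    have mono: "incseq (\<lambda>i. U i x)" for x
      using seq(3) by (auto simp: incseq_def le_fun_def)
    have "(\<integral>\<^sup>+x. (SUP i. U i) x \<partial>add_dirac N S) = (SUP i. \<integral>\<^sup>+x. U i x \<partial>add_dirac N S)"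
      unfolding SUP_apply by (rule nn_integral_monotone_convergence_SUP[OF seq(3) meas(2)[OF seq(1)]])
    also have "\<dots> = (SUP i. (\<integral>\<^sup>+x. U i x \<partial>N) + (\<Sum>x\<in>S. U i x))"
      using seq.IH by simp
    also have "\<dots> = (SUP i. \<integral>\<^sup>+x. U i x \<partial>N) + (SUP i. \<Sum>x\<in>S. U i x)"
    proof (rule ennreal_SUP_add)
      show "incseq (\<lambda>i. \<integral>\<^sup>+x. U i x \<partial>N)"
        using seq(3) by (auto simp: incseq_def le_fun_def intro!: nn_integral_mono)
      show "incseq (\<lambda>i. \<Sum>x\<in>S. U i x)"
        using seq(3) by (auto simp: incseq_def le_fun_def intro!: sum_mono)
    qed
    also have "(SUP i. \<integral>\<^sup>+x. U i x \<partial>N) = (\<integral>\<^sup>+x. (SUP i. U i) x \<partial>N)"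
      unfolding SUP_apply by (rule nn_integral_monotone_convergence_SUP[OF seq(3) meas(1)[OF seq(1)], symmetric])
    also have "(SUP i. \<Sum>x\<in>S. U i x) = (\<Sum>x\<in>S. (SUP i. U i) x)"
      unfolding SUP_apply using mono by (intro ennreal_SUP_sum) 
    finally show ?case .
  qed
qed

section \<open>Uniqueness of Laplace functionals\<close>

text \<open>A finite signed measure on the unit interval is determined by its moments. Here the
  measures are the images under \<open>Y\<close> of \<open>M\<close> and \<open>N\<close> with
  density \<open>G\<close>. The bound on \<open>G\<close> gives integrability and
  domination.\<close>

lemma integral_indicator_le_eq_of_moments:
  fixes Y G :: "'b \<Rightarrow> real"
  assumes fin: "finite_measure M" "finite_measure N" and sets: "sets N = sets M"
    and Y [measurable]: "Y \<in> borel_measurable M" and Y01: "\<And>x. x \<in> space M \<Longrightarrow> Y x \<in> {0..1}"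
    and G [measurable]: "G \<in> borel_measurable M" and G1: "\<And>x. x \<in> space M \<Longrightarrow> \<bar>G x\<bar> \<le> 1"
    and eq: "\<And>k. (\<integral>x. Y x ^ k * G x \<partial>M) = (\<integral>x. Y x ^ k * G x \<partial>N)"
  shows "(\<integral>x. indicator {..a} (Y x) * G x \<partial>M) = (\<integral>x. indicator {..a} (Y x) * G x \<partial>N)"
proof -
  \<comment> \<open>For positive \<open>m\<close> the function \<open>h m\<close> is 1 up to
    \<open>a\<close>, falls linearly to 0 over an interval of length \<open>1 / m\<close>, and
    vanishes from there on. Its limit is the indicator of \<open>{..a}\<close>, endpoint
    included.\<close>
  define h where "h m y = max 0 (min 1 (1 - real m * (y - a)))" for m y
  \<comment> \<open>The tolerance tends to 0, so the polynomials have the same pointwise limit as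
    \<open>h m\<close>. It is also at most 1, so on the unit interval they are bounded by 2, the
    dominating constant used below.\<close>
  have "\<exists>q. real_polynomial_function q \<and> (\<forall>y\<in>{0..1}. \<bar>h m y - q y\<bar> < 1 / real (Suc m))" for m
  proof -
    have "continuous_on {0..1} (h m)"
      unfolding h_def by (intro continuous_intros)
    from Stone_Weierstrass_real_polynomial_function[OF compact_Icc this, of "1 / real (Suc m)"]
    show ?thesis by (metis of_nat_0_less_iff zero_less_Suc zero_less_divide_1_iff)
  qed
  then obtain q where q: "\<And>m. real_polynomial_function (q m)"
    and hq: "\<And>m y. y \<in> {0..1} \<Longrightarrow> \<bar>h m y - q m y\<bar> < 1 / real (Suc m)"
    by metis
  have qm [measurable]: "q m \<in> borel_measurable borel" for m
    using q[of m] by (intro borel_measurable_continuous_onI)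
      (simp add: continuous_on_polymonial_function real_polynomial_function_eq)
  have h01: "0 \<le> h m y" "h m y \<le> 1" for m y
    by (auto simp: h_def)
  have q2: "\<bar>q m y\<bar> \<le> 2" if "y \<in> {0..1}" for m y
  proof -
    have "1 / real (Suc m) \<le> 1" by simp
    with hq[OF that, of m] h01[of m y] show ?thesis by linarith
  qed
  have lim_h: "(\<lambda>m. h m y) \<longlonglongrightarrow> indicator {..a} y" for y
  proof (cases "y \<le> a")
    case True
    then have "h m y = 1" for m
      by (simp add: h_def mult_nonneg_nonpos)
    with True show ?thesis by simp
  next
    case False
    \<comment> \<open>Once \<open>m\<close> reaches \<open>1 / (y - a)\<close>, the linear piece of
      \<open>h m\<close> ends no later than at \<open>y\<close>.\<close>
    have "\<forall>\<^sub>F m in sequentially. h m y = 0"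
      using eventually_ge_at_top[of "nat \<lceil>1 / (y - a)\<rceil>"]
    proof eventually_elim
      case (elim m)
      then have "1 / (y - a) \<le> real m" by linarith
      with False have "1 \<le> real m * (y - a)" by (simp add: divide_simps)
      then show ?case by (simp add: h_def)
    qed
    with False show ?thesis by (simp add: tendsto_eventually)
  qed
  have lim_q: "(\<lambda>m. q m y) \<longlonglongrightarrow> indicator {..a} y" if "y \<in> {0..1}" for y
  proof -
    have "(\<lambda>m. h m y - q m y) \<longlonglongrightarrow> 0"
    proof (rule Lim_null_comparison[OF _ LIMSEQ_inverse_real_of_nat])
      show "\<forall>\<^sub>F m in sequentially. norm (h m y - q m y) \<le> inverse (real (Suc m))"
        using hq[OF that] by (intro always_eventually) (simp add: less_imp_le inverse_eq_divide)
    qed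
    from tendsto_diff[OF lim_h[of y] this] show ?thesis by simp
  qed
  have lim_int: "(\<lambda>m. \<integral>x. q m (Y x) * G x \<partial>L) \<longlonglongrightarrow> (\<integral>x. indicator {..a} (Y x) * G x \<partial>L)"
    if L: "finite_measure L" "sets L = sets M" for L
  proof (rule integral_dominated_convergence[where w = "\<lambda>_. 2"])
    interpret finite_measure L by (rule L(1))
    have spL: "space L = space M" using L(2) by (rule sets_eq_imp_space_eq)
    have [measurable]: "Y \<in> borel_measurable L" "G \<in> borel_measurable L"
      using Y G L(2) measurable_cong_sets by blast+
    show "(\<lambda>x. indicator {..a} (Y x) * G x) \<in> borel_measurable L" by measurable
    show "(\<lambda>x. q m (Y x) * G x) \<in> borel_measurable L" for m by measurable
    show "integrable L (\<lambda>_. 2 :: real)" by simp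
    show "AE x in L. (\<lambda>m. q m (Y x) * G x) \<longlonglongrightarrow> indicator {..a} (Y x) * G x"
      using Y01 spL by (intro AE_I2 tendsto_mult lim_q tendsto_const) auto
    show "AE x in L. norm (q m (Y x) * G x) \<le> 2" for m
    proof (rule AE_I2)
      fix x assume "x \<in> space L"
      then show "norm (q m (Y x) * G x) \<le> 2"
        using mult_mono[OF q2[OF Y01] G1, of x x m] spL by (auto simp: abs_mult)
    qed
  qed
  have "(\<integral>x. q m (Y x) * G x \<partial>M) = (\<integral>x. q m (Y x) * G x \<partial>N)" for m
  proof -
    obtain b d where qs: "q m = (\<lambda>y. \<Sum>i\<le>d. b i * y ^ i)"
      using q[of m] unfolding real_polynomial_function_iff_sum by blast
    have "(\<integral>x. q m (Y x) * G x \<partial>L) = (\<Sum>i\<le>d. b i * (\<integral>x. Y x ^ i * G x \<partial>L))"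
      if L: "finite_measure L" "sets L = sets M" for L
    proof -
      interpret finite_measure L by (rule L(1))
      have spL: "space L = space M" using L(2) by (rule sets_eq_imp_space_eq)
      have [measurable]: "Y \<in> borel_measurable L" "G \<in> borel_measurable L"
        using Y G L(2) measurable_cong_sets by blast+
      have int: "integrable L (\<lambda>x. Y x ^ i * G x)" for i
      proof (rule integrable_const_bound[where B = 1])
        show "AE x in L. norm (Y x ^ i * G x) \<le> 1"
        proof (rule AE_I2)
          fix x assume "x \<in> space L"
          then have "\<bar>Y x ^ i\<bar> \<le> 1" "\<bar>G x\<bar> \<le> 1"
            using Y01[of x] G1[of x] spL by (auto simp: power_le_one power_abs)
          then show "norm (Y x ^ i * G x) \<le> 1"
            using mult_mono[of "\<bar>Y x ^ i\<bar>" 1 "\<bar>G x\<bar>" 1] by (simp add: abs_mult)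
        qed
      qed measurable
      have "(\<integral>x. q m (Y x) * G x \<partial>L) = (\<integral>x. (\<Sum>i\<le>d. b i * (Y x ^ i * G x)) \<partial>L)"
        by (simp add: qs sum_distrib_right mult.assoc)
      also have "\<dots> = (\<Sum>i\<le>d. b i * (\<integral>x. Y x ^ i * G x \<partial>L))"
        using int by (subst Bochner_Integration.integral_sum) auto
      finally show ?thesis .
    qed
    then show ?thesis
      using fin sets eq by simp
  qed
  with lim_int[OF fin(1) refl] lim_int[OF fin(2) sets] show ?thesis
    using LIMSEQ_unique by fastforce
qed

text \<open>The factors of a product of members of \<open>F\<close> are replaced by indicators one at a time.\<close>

lemma integral_prod_indicator_eq:
  fixes F :: "('b \<Rightarrow> real) set"
  assumes fin: "finite_measure M" "finite_measure N" and sets: "sets N = sets M"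
    and F: "\<And>Y. Y \<in> F \<Longrightarrow> Y \<in> borel_measurable M"
    and F01: "\<And>Y x. Y \<in> F \<Longrightarrow> x \<in> space M \<Longrightarrow> Y x \<in> {0..1}"
    and mult: "\<And>Y Z. Y \<in> F \<Longrightarrow> Z \<in> F \<Longrightarrow> (\<lambda>x. Y x * Z x) \<in> F"
    and eq: "\<And>Y. Y \<in> F \<Longrightarrow> (\<integral>x. Y x \<partial>M) = (\<integral>x. Y x \<partial>N)"
    and ys: "fst ` set ys \<subseteq> F" and Z: "Z \<in> F"
  shows "(\<integral>x. Z x * (\<Prod>(Y, a)\<leftarrow>ys. indicator {..a} (Y x)) \<partial>M) =
         (\<integral>x. Z x * (\<Prod>(Y, a)\<leftarrow>ys. indicator {..a} (Y x)) \<partial>N)"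
  using ys Z
proof (induction ys arbitrary: Z)
  case Nil
  then show ?case using eq by simp
next
  case (Cons p ys)
  obtain Y a where p: "p = (Y, a)" by (cases p)
  define H where "H = (\<lambda>x. \<Prod>(Y, a)\<leftarrow>ys. indicator {..a} (Y x) :: real)"
  have Y: "Y \<in> F" using Cons.prems p by simp
  have ysF: "fst ` set ys \<subseteq> F" using Cons.prems by simp
  have H: "H \<in> borel_measurable M"
    using ysF unfolding H_def
  proof (induction ys)
    case (Cons p ys)
    obtain X b where p: "p = (X, b)" by (cases p)
    have [measurable]: "X \<in> borel_measurable M" using Cons.prems F p by simp
    have [measurable]: "(\<lambda>x. \<Prod>(Y, a)\<leftarrow>ys. indicator {..a} (Y x) :: real) \<in> borel_measurable M"
      using Cons by simp
    show ?case by (simp add: p)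
  qed simp
  have H1: "\<bar>H x\<bar> \<le> 1" for x
    unfolding H_def
  proof (induction ys)
    case (Cons p ys)
    then show ?case
      by (cases p) (auto simp: abs_mult indicator_def)
  qed simp
  \<comment> \<open>These products are admissible choices of \<open>Z\<close> in the induction
    hypothesis, which thereby yields every moment of \<open>Y\<close> against the weight
    \<open>Z x * H x\<close>.\<close>
  have powers: "(\<lambda>x. Y x ^ k * Z x) \<in> F" for k
  proof (induction k)
    case (Suc k)
    from mult[OF Y this] show ?case by (simp add: mult.assoc)
  qed (use Cons.prems in simp)
  have "(\<integral>x. indicator {..a} (Y x) * (Z x * H x) \<partial>M) = (\<integral>x. indicator {..a} (Y x) * (Z x * H x) \<partial>N)"
  proof (rule integral_indicator_le_eq_of_moments[OF fin sets F[OF Y] F01[OF Y]])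
    show "(\<lambda>x. Z x * H x) \<in> borel_measurable M"
      using F[OF Cons.prems(2)] H by measurable
    show "\<bar>Z x * H x\<bar> \<le> 1" if "x \<in> space M" for x
      using mult_mono[of "\<bar>Z x\<bar>" 1 "\<bar>H x\<bar>" 1] H1[of x] F01[OF Cons.prems(2) that]
      by (simp add: abs_mult)
    show "(\<integral>x. Y x ^ k * (Z x * H x) \<partial>M) = (\<integral>x. Y x ^ k * (Z x * H x) \<partial>N)" for k
      using Cons.IH[OF ysF powers[of k]] by (simp add: H_def mult.assoc)
  qed
  then show ?case
    by (simp add: p H_def mult_ac)
qed

text \<open>A multiplicative class theorem. Finite intersections of the sets on which some
  \<open>Y\<close> in \<open>F\<close> is at most \<open>a\<close> form an intersection-stable
  generator, and their indicators have equal integrals by the exchange of factors that starts from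
  the constant 1. The assumption \<open>gen\<close> expresses by minimality that \<open>F\<close>
  generates the sigma-field, so that it can be verified without exhibiting a generator.\<close>

lemma finite_measure_eqI_multiplicative:
  fixes F :: "('b \<Rightarrow> real) set"
  assumes fin: "finite_measure M" "finite_measure N" and sets: "sets N = sets M"
    and F: "\<And>Y. Y \<in> F \<Longrightarrow> Y \<in> borel_measurable M"
    and F01: "\<And>Y x. Y \<in> F \<Longrightarrow> x \<in> space M \<Longrightarrow> Y x \<in> {0..1}"
    and one: "(\<lambda>_. 1) \<in> F"
    and mult: "\<And>Y Z. Y \<in> F \<Longrightarrow> Z \<in> F \<Longrightarrow> (\<lambda>x. Y x * Z x) \<in> F"
    and gen: "\<And>L. space L = space M \<Longrightarrow> (\<And>Y. Y \<in> F \<Longrightarrow> Y \<in> borel_measurable L) \<Longrightarrow> sets M \<subseteq> sets L"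
    and eq: "\<And>Y. Y \<in> F \<Longrightarrow> (\<integral>x. Y x \<partial>M) = (\<integral>x. Y x \<partial>N)"
  shows "M = N"
proof -
  interpret M: finite_measure M by (rule fin(1))
  interpret N: finite_measure N by (rule fin(2))
  have sp: "space N = space M"
    using sets by (rule sets_eq_imp_space_eq)
  \<comment> \<open>Constraints are kept in lists: concatenation gives intersections, the empty list
    gives the whole space, and the indicator is a list product of the shape treated in
    \<open>integral_prod_indicator_eq\<close>.\<close>
  define cyl where "cyl ys = {x \<in> space M. \<forall>(Y, a)\<in>set ys. Y x \<le> a}" for ys :: "(('b \<Rightarrow> real) \<times> real) list"
  define E where "E = cyl ` {ys. fst ` set ys \<subseteq> F}"
  have ind: "indicator (cyl ys) x = (\<Prod>(Y, a)\<leftarrow>ys. indicator {..a} (Y x) :: real)"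
    if "x \<in> space M" for ys x
  proof (induction ys)
    case (Cons p ys)
    have "indicator (cyl (p # ys)) x = (indicator {..snd p} (fst p x) * indicator (cyl ys) x :: real)"
      by (auto simp: cyl_def indicator_def)
    with Cons show ?case by (simp add: case_prod_beta)
  qed (use that in \<open>simp add: cyl_def\<close>)
  have cyl: "cyl ys \<in> sets M" if "fst ` set ys \<subseteq> F" for ys
    using that
  proof (induction ys)
    case (Cons p ys)
    have [measurable]: "fst p \<in> borel_measurable M" "cyl ys \<in> sets M"
      using Cons F by auto
    have "cyl (p # ys) = {x \<in> space M. fst p x \<le> snd p} \<inter> cyl ys"
      by (auto simp: cyl_def)
    then show ?case by simp
  qed (simp add: cyl_def)
  have sigma: "sets M = sigma_sets (space M) E"
  proof (rule antisym)
    have EP: "E \<subseteq> Pow (space M)" by (auto simp: E_def cyl_def)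
    have "sets M \<subseteq> sets (sigma (space M) E)"
    proof (rule gen)
      fix Y assume Y: "Y \<in> F"
      show "Y \<in> borel_measurable (sigma (space M) E)"
      proof (rule borel_measurableI_le)
        fix a
        have "cyl [(Y, a)] \<in> E" unfolding E_def using Y by (intro imageI) simp
        then show "{x \<in> space (sigma (space M) E). Y x \<le> a} \<in> sets (sigma (space M) E)"
          using EP by (simp add: cyl_def)
      qed
    qed (simp add: EP)
    then show "sets M \<subseteq> sigma_sets (space M) E" by (simp add: EP)
    show "sigma_sets (space M) E \<subseteq> sets M"
      using cyl by (intro sets.sigma_sets_subset) (auto simp: E_def)
  qed
  show ?thesis
  proof (rule measure_eqI_generator_eq[where E = E and \<Omega> = "space M" and A = "\<lambda>_. space M"])
    show "Int_stable E"
    proof (rule Int_stableI)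
      fix A B assume "A \<in> E" "B \<in> E"
      then obtain ys zs where "A = cyl ys" "B = cyl zs" "fst ` set ys \<subseteq> F" "fst ` set zs \<subseteq> F"
        by (auto simp: E_def)
      then have "A \<inter> B = cyl (ys @ zs)" "fst ` set (ys @ zs) \<subseteq> F"
        by (auto simp: cyl_def)
      then show "A \<inter> B \<in> E" by (auto simp: E_def)
    qed
    show "E \<subseteq> Pow (space M)" by (auto simp: E_def cyl_def)
    show "sets M = sigma_sets (space M) E" "sets N = sigma_sets (space M) E"
      using sigma sets by auto
    show "range (\<lambda>_. space M) \<subseteq> E"
      by (auto simp: E_def cyl_def intro!: image_eqI[of _ _ "[]"])
    fix X assume "X \<in> E"
    then obtain ys where X: "X = cyl ys" and ys: "fst ` set ys \<subseteq> F"
      by (auto simp: E_def)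
    have "measure M X = (\<integral>x. indicator X x \<partial>M)"
      using cyl[OF ys] X sets.sets_into_space by (simp add: Int_absorb2)
    also have "\<dots> = (\<integral>x. 1 * (\<Prod>(Y, a)\<leftarrow>ys. indicator {..a} (Y x)) \<partial>M)"
      by (intro Bochner_Integration.integral_cong) (simp_all add: X ind)
    also have "\<dots> = (\<integral>x. 1 * (\<Prod>(Y, a)\<leftarrow>ys. indicator {..a} (Y x)) \<partial>N)"
      by (rule integral_prod_indicator_eq[OF fin sets F _ mult eq ys one]) (assumption | erule (1) F01)+
    also have "\<dots> = (\<integral>x. indicator X x \<partial>N)"
      by (intro Bochner_Integration.integral_cong) (simp_all add: X ind sp)
    also have "\<dots> = measure N X"
      using cyl[OF ys] X sets sets.sets_into_space[of X M] sp by (simp add: Int_absorb2)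
    finally show "emeasure M X = emeasure N X"
      by (simp add: M.emeasure_eq_measure N.emeasure_eq_measure)
  qed auto
qed

section \<open>Laplace factors of boundedly finite measures\<close>

lemma exp_neg_0 [simp]: "exp_neg 0 = 1"
  by (simp add: exp_neg_def)

lemma exp_neg_ennreal [simp]: "0 \<le> r \<Longrightarrow> exp_neg (ennreal r) = exp (- r)"
  by (simp add: exp_neg_def)

lemma exp_neg_nonneg [simp]: "0 \<le> exp_neg t"
  and exp_neg_le_1 [simp]: "exp_neg t \<le> 1"
  by (auto simp: exp_neg_def)

text \<open>The value 0 of \<open>exp_neg\<close> at infinity is the one for which the rule survives
  infinite summands.\<close>

lemma exp_neg_add: "exp_neg (s + t) = exp_neg s * exp_neg t"
  by (cases s; cases t) (auto simp: exp_neg_def mult_exp_exp ennreal_plus[symmetric] simp del: ennreal_plus)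

lemma exp_neg_sum: "finite I \<Longrightarrow> exp_neg (\<Sum>i\<in>I. t i) = (\<Prod>i\<in>I. exp_neg (t i))"
  by (induction I rule: finite_induct) (auto simp: exp_neg_add)

lemma measurable_exp_neg [measurable]: "exp_neg \<in> borel_measurable borel"
  unfolding exp_neg_def by measurable

lemma BM_plus_add: "f \<in> BM_plus \<Longrightarrow> g \<in> BM_plus \<Longrightarrow> (\<lambda>x. f x + g x) \<in> BM_plus"
  by (auto simp: BM_plus_def intro: bounded_subset[of "{x. f x \<noteq> 0} \<union> {x. g x \<noteq> 0}"])

lemma BM_plus_0: "(\<lambda>_. 0) \<in> BM_plus"
  by (simp add: BM_plus_def)

lemma BM_plusD:
  assumes "f \<in> BM_plus"
  shows "f \<in> borel_measurable borel" "0 \<le> f x" "bounded {x. f x \<noteq> 0}"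
  using assms by (auto simp: BM_plus_def)

lemma measurable_nn_integral_bfm:
  assumes "f \<in> borel_measurable borel"
  shows "(\<lambda>N. \<integral>\<^sup>+x. ennreal (f x) \<partial>N) \<in> borel_measurable bfm"
proof -
  have "(\<lambda>z. ennreal (f (snd z))) \<in> borel_measurable (bfm \<Otimes>\<^sub>M borel)"
    using measurable_compose[OF measurable_snd assms] by measurable
  from measurable_nn_integral_kernel[OF measurable_ident_sets[OF refl] this] show ?thesis
    by simp
qed

lemma measurable_exp_neg_nn_integral:
  assumes "f \<in> BM_plus"
  shows "(\<lambda>N. exp_neg (\<integral>\<^sup>+x. ennreal (f x) \<partial>N)) \<in> borel_measurable bfm"
  using measurable_nn_integral_bfm[OF BM_plusD(1)[OF assms]] by measurable

text \<open>Adding two simple functions of bounded support multiplies the corresponding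
  exponentials, so these form a multiplicative class. They generate because the indicators of
  bounded Borel sets are among the functions.\<close>

lemma finite_measure_bfm_eqI_laplace:
  fixes Q R :: "'a::polish_space measure measure"
  assumes fin: "finite_measure Q" "finite_measure R"
    and sets: "sets Q = sets bfm" "sets R = sets bfm"
    and eq: "\<And>f. f \<in> BM_plus \<Longrightarrow> finite (range f) \<Longrightarrow> laplace Q f = laplace R f"
  shows "Q = R"
proof -
  have sp: "space Q = bfm_set"
    using sets_eq_imp_space_eq[OF sets(1)] by simp
  define Y where "Y f = (\<lambda>N. if N \<in> bfm_set then exp_neg (\<integral>\<^sup>+x. ennreal (f x) \<partial>N) else 1)"
    for f :: "'a \<Rightarrow> real"
  define C where "C = {f :: 'a \<Rightarrow> real. f \<in> BM_plus \<and> finite (range f)}"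
  have YQ: "Y f \<in> borel_measurable Q" if "f \<in> C" for f
  proof -
    have "Y f \<in> borel_measurable bfm \<longleftrightarrow> (\<lambda>N. exp_neg (\<integral>\<^sup>+x. ennreal (f x) \<partial>N)) \<in> borel_measurable bfm"
      by (intro measurable_cong) (simp add: Y_def)
    then show ?thesis
      using measurable_exp_neg_nn_integral[of f] that
      unfolding measurable_cong_sets[OF sets(1) refl] by (simp add: C_def)
  qed
  have C_add: "(\<lambda>x. f x + g x) \<in> C" if "f \<in> C" "g \<in> C" for f g
  proof -
    have "range (\<lambda>x. f x + g x) \<subseteq> (\<lambda>(s, t). s + t) ` (range f \<times> range g)" by auto
    moreover have "finite ((\<lambda>(s, t). s + t) ` (range f \<times> range g))"
      using that by (simp add: C_def)
    ultimately have "finite (range (\<lambda>x. f x + g x))"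
      by (rule finite_subset)
    then show ?thesis
      using that by (simp add: C_def BM_plus_add)
  qed
  show ?thesis
  proof (rule finite_measure_eqI_multiplicative[OF fin, where F = "Y ` C"])
    show "sets R = sets Q" by (simp add: sets)
    show "(\<lambda>_. 1) \<in> Y ` C"
      by (rule image_eqI[where x = "\<lambda>_. 0"]) (auto simp: Y_def C_def BM_plus_0)
    fix Z assume "Z \<in> Y ` C"
    then obtain f where f: "f \<in> C" and Z: "Z = Y f" by auto
    show "Z \<in> borel_measurable Q" unfolding Z by (rule YQ[OF f])
    show "Z N \<in> {0..1}" for N by (simp add: Z Y_def)
    have "laplace S f = (\<integral>N. Z N \<partial>S)" if "sets S = sets bfm" for S
      unfolding laplace_def using sets_eq_imp_space_eq[OF that]
      by (intro Bochner_Integration.integral_cong) (simp_all add: Z Y_def)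
    then show "(\<integral>N. Z N \<partial>Q) = (\<integral>N. Z N \<partial>R)"
      using eq[of f] f sets by (simp add: C_def)
    fix Z' assume "Z' \<in> Y ` C"
    then obtain g where g: "g \<in> C" and Z': "Z' = Y g" by auto
    have "Z N * Z' N = Y (\<lambda>x. f x + g x) N" for N
    proof (cases "N \<in> bfm_set")
      case True
      have "(\<integral>\<^sup>+x. ennreal (f x + g x) \<partial>N) = (\<integral>\<^sup>+x. ennreal (f x) \<partial>N) + (\<integral>\<^sup>+x. ennreal (g x) \<partial>N)"
      proof (subst nn_integral_add[symmetric])
        show "(\<lambda>x. ennreal (f x)) \<in> borel_measurable N" "(\<lambda>x. ennreal (g x)) \<in> borel_measurable N"
          using f g measurable_cong_sets[OF sets_bfm_set[OF True] refl]
          by (auto simp: C_def BM_plus_def)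
      qed (use f g in \<open>auto simp: C_def BM_plus_def intro!: nn_integral_cong\<close>)
      then show ?thesis
        using True by (simp add: Z Z' Y_def exp_neg_add)
    qed (simp add: Z Z' Y_def)
    then show "(\<lambda>N. Z N * Z' N) \<in> Y ` C"
      using C_add[OF f g] by auto
  next
    fix L :: "'a measure measure"
    assume spL: "space L = space Q" and L: "\<And>Z. Z \<in> Y ` C \<Longrightarrow> Z \<in> borel_measurable L"
    have id: "(\<lambda>N. N) \<in> measurable L bfm"
    proof (rule measurable_bfmI_bounded)
      show "N \<in> bfm_set" if "N \<in> space L" for N using that spL sp by simp
      fix A :: "'a set" assume A: "A \<in> sets borel" "bounded A"
      have "(indicator A :: 'a \<Rightarrow> real) \<in> C"
        using A by (auto simp: C_def BM_plus_def indicator_def image_def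
            intro: finite_subset[of _ "{0, 1}"] bounded_subset)
      then have [measurable]: "Y (indicator A) \<in> borel_measurable L"
        using L by auto
      \<comment> \<open>The mass of the bounded set \<open>A\<close> is finite, hence its
        \<open>exp_neg\<close> is positive and the logarithm recovers the mass.\<close>
      have "(\<lambda>N. ennreal (- ln (Y (indicator A) N))) \<in> borel_measurable L"
        by measurable
      then show "(\<lambda>N. emeasure N A) \<in> borel_measurable L"
      proof (rule measurable_cong[THEN iffD1, rotated])
        fix N assume "N \<in> space L"
        then have N: "N \<in> bfm_set" using spL sp by simp
        have "(\<integral>\<^sup>+x. ennreal (indicator A x) \<partial>N) = emeasure N A"
          using A(1) by (simp add: ennreal_indicator sets_bfm_set[OF N])
        then show "ennreal (- ln (Y (indicator A) N)) = emeasure N A"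
          using N emeasure_bfm_bounded[OF N A] by (simp add: Y_def exp_neg_def less_top)
      qed
    qed
    show "sets Q \<subseteq> sets L"
    proof
      fix X assume "X \<in> sets Q"
      then have "X \<in> sets bfm" "X \<subseteq> space L"
        using sets spL sets.sets_into_space[of X Q] by auto
      then show "X \<in> sets L"
        using measurable_sets[OF id, of X] by (simp add: Int_absorb2)
    qed
  qed
qed

section \<open>Mecke's formula\<close>

lemma poisson_lawD:
  assumes "poisson_law \<nu> P"
  shows poisson_law_prob_space: "prob_space P"
    and poisson_law_sets: "sets P = sets bfm"
    and poisson_law_space: "space P = bfm_set"
  using assms sets_eq_imp_space_eq[of P bfm] by (auto simp: poisson_law_def)

lemma measurable_poisson_law:
  "poisson_law \<nu> P \<Longrightarrow> f \<in> measurable P M \<longleftrightarrow> f \<in> measurable bfm M"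
  using measurable_cong_sets[OF poisson_law_sets refl] by blast

text \<open>\<open>poisson_law\<close> prescribes only the probabilities of the natural numbers.
  Since these add up to 1, all other values of the count, infinity in particular, have probability
  0, and the expectation becomes a series.\<close>

lemma nn_integral_poisson_count:
  fixes \<phi> :: "ennreal \<Rightarrow> ennreal"
  assumes P: "poisson_law \<nu> P" and B: "B \<in> sets borel" "bounded B"
  shows "(\<integral>\<^sup>+N. \<phi> (emeasure N B) \<partial>P) =
    (\<Sum>k. \<phi> (of_nat k) * ennreal (measure \<nu> B ^ k / fact k * exp (- measure \<nu> B)))"
proof -
  interpret prob_space P by (rule poisson_law_prob_space[OF P])
  define p where "p k = measure \<nu> B ^ k / fact k * exp (- measure \<nu> B)" for k :: nat
  define D where "D k = {N \<in> space P. emeasure N B = of_nat k}" for k :: nat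
  have [measurable]: "(\<lambda>N. emeasure N B) \<in> borel_measurable P"
    using B(1) by (simp add: measurable_poisson_law[OF P])
  have D [measurable]: "D k \<in> sets P" for k
    unfolding D_def by measurable
  have prob_D: "prob (D k) = p k" for k
    using P B by (simp add: poisson_law_def D_def p_def)
  have disj: "disjoint_family D"
    by (auto simp: disjoint_family_on_def D_def)
  have "p sums 1"
  proof -
    have "(\<lambda>k. (measure \<nu> B ^ k /\<^sub>R fact k) * exp (- measure \<nu> B)) sums
        (exp (measure \<nu> B) * exp (- measure \<nu> B))"
      by (intro sums_mult2 exp_converges)
    then show ?thesis
      by (simp add: p_def[abs_def] exp_minus divide_inverse mult.commute)
  qed
  moreover have "(\<lambda>k. prob (D k)) sums prob (\<Union>k. D k)"
    using D disj by (intro finite_measure_UNION) auto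
  ultimately have "prob (\<Union>k. D k) = 1"
    using sums_unique2 by (auto simp: prob_D)
  then have AE_D: "AE N in P. N \<in> (\<Union>k. D k)"
    by (subst AE_in_set_eq_1) auto
  have "(\<integral>\<^sup>+N. \<phi> (emeasure N B) \<partial>P) = (\<integral>\<^sup>+N. (\<Sum>k. \<phi> (of_nat k) * indicator (D k) N) \<partial>P)"
  proof (rule nn_integral_cong_AE)
    show "AE N in P. \<phi> (emeasure N B) = (\<Sum>k. \<phi> (of_nat k) * indicator (D k) N)"
      using AE_D
    proof eventually_elim
      case (elim N)
      then obtain k where k: "N \<in> D k" by auto
      then have "(\<Sum>k. \<phi> (of_nat k) * indicator (D k) N) = (\<Sum>j\<in>{k}. \<phi> (of_nat j) * indicator (D j) N)"
        by (intro suminf_finite) (auto simp: D_def indicator_def)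
      with k show ?case by (simp add: D_def)
    qed
  qed
  also have "\<dots> = (\<Sum>k. \<integral>\<^sup>+N. \<phi> (of_nat k) * indicator (D k) N \<partial>P)"
    by (intro nn_integral_suminf) measurable
  also have "\<dots> = (\<Sum>k. \<phi> (of_nat k) * ennreal (p k))"
    by (simp add: nn_integral_cmult_indicator emeasure_eq_measure prob_D)
  finally show ?thesis by (simp add: p_def)
qed

lemma exp_neg_cmult_of_nat:
  "0 \<le> r \<Longrightarrow> exp_neg (ennreal r * of_nat k) = exp (- r) ^ k"
  by (simp add: ennreal_of_nat_eq_real_of_nat ennreal_mult[symmetric] exp_of_nat_mult[symmetric]
      mult.commute)

text \<open>The index of the Poisson series is shifted by one, using
  \<open>k * l ^ k / fact k = l * l ^ (k - 1) / fact (k - 1)\<close> for \<open>k > 0\<close>.\<close>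

lemma nn_integral_poisson_size_bias:
  assumes \<nu>: "\<nu> \<in> bfm_set" and P: "poisson_law \<nu> P" and B: "B \<in> sets borel" "bounded B" and r: "0 \<le> r"
  shows "(\<integral>\<^sup>+N. emeasure N B * ennreal (exp_neg (ennreal r * emeasure N B)) \<partial>P) =
    ennreal (exp (- r)) * emeasure \<nu> B * (\<integral>\<^sup>+N. ennreal (exp_neg (ennreal r * emeasure N B)) \<partial>P)"
proof -
  define l where "l = measure \<nu> B"
  have l: "emeasure \<nu> B = ennreal l"
    using emeasure_bfm_bounded[OF \<nu> B] by (simp add: l_def emeasure_eq_ennreal_measure less_top)
  have l0: "0 \<le> l" by (simp add: l_def)
  define t where "t k = exp (- r) ^ k * (l ^ k / fact k * exp (- l))" for k :: nat
  have t0: "0 \<le> t k" for k using l0 by (simp add: t_def)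
  have "(\<integral>\<^sup>+N. emeasure N B * ennreal (exp_neg (ennreal r * emeasure N B)) \<partial>P) =
      (\<Sum>k. ennreal (real k * t k))"
    unfolding nn_integral_poisson_count[OF P B, where \<phi> = "\<lambda>s. s * ennreal (exp_neg (ennreal r * s))"]
      exp_neg_cmult_of_nat[OF r]
    using l0 by (simp add: t_def l_def[symmetric] ennreal_of_nat_eq_real_of_nat
        ennreal_mult[symmetric] mult.assoc)
  \<comment> \<open>The term for \<open>k = 0\<close> vanishes because of the factor
    \<open>real k\<close>, so the shift loses nothing.\<close>
  also have "\<dots> = (\<Sum>k. ennreal (real (Suc k) * t (Suc k)))"
    using suminf_offset[of "\<lambda>k. ennreal (real k * t k)" 1] by (simp add: summableI Suc_eq_plus1)
  also have "\<dots> = (\<Sum>k. ennreal (exp (- r) * l) * ennreal (t k))"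
  proof (rule suminf_cong)
    fix k
    have "real (Suc k) * t (Suc k) = exp (- r) * l * t k"
      by (simp add: t_def fact_Suc field_simps del: of_nat_Suc)
    then show "ennreal (real (Suc k) * t (Suc k)) = ennreal (exp (- r) * l) * ennreal (t k)"
      using t0 l0 by (simp add: ennreal_mult)
  qed
  also have "\<dots> = ennreal (exp (- r) * l) * (\<Sum>k. ennreal (t k))"
    by (rule ennreal_suminf_cmult)
  also have "(\<Sum>k. ennreal (t k)) = (\<integral>\<^sup>+N. ennreal (exp_neg (ennreal r * emeasure N B)) \<partial>P)"
    unfolding nn_integral_poisson_count[OF P B, where \<phi> = "\<lambda>s. ennreal (exp_neg (ennreal r * s))"]
    using l0 by (simp add: exp_neg_cmult_of_nat r t_def l_def[symmetric] ennreal_mult[symmetric])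
  finally show ?thesis
    using l0 by (simp add: l ennreal_mult)
qed

text \<open>The level 0 is left out because its level set may be unbounded. The other level sets lie
  in the bounded support, so \<open>poisson_law\<close> applies to their counts.\<close>

lemma nn_integral_simple_bfm:
  assumes N: "N \<in> bfm_set" and f: "f \<in> BM_plus" "finite (range f)"
  shows "(\<integral>\<^sup>+x. ennreal (f x) \<partial>N) = (\<Sum>s\<in>range f - {0}. ennreal s * emeasure N (f -` {s}))"
proof -
  have meas: "f -` {s} \<in> sets N" for s
    using measurable_sets[OF BM_plusD(1)[OF f(1)], of "{s}"] by (simp add: sets_bfm_set[OF N])
  have "ennreal (f x) = (\<Sum>s\<in>range f - {0}. ennreal s * indicator (f -` {s}) x)" for x
  proof (cases "f x = 0")
    case False
    have "(\<Sum>s\<in>range f - {0}. ennreal s * indicator (f -` {s}) x) =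
        (\<Sum>s\<in>range f - {0}. if s = f x then ennreal s else 0)"
      by (intro sum.cong) auto
    then show ?thesis using f(2) False by simp
  qed (auto simp: indicator_def)
  then have "(\<integral>\<^sup>+x. ennreal (f x) \<partial>N) = (\<integral>\<^sup>+x. (\<Sum>s\<in>range f - {0}. ennreal s * indicator (f -` {s}) x) \<partial>N)"
    by simp
  also have "\<dots> = (\<Sum>s\<in>range f - {0}. ennreal s * emeasure N (f -` {s}))"
    using meas by (subst nn_integral_sum) (auto simp: nn_integral_cmult_indicator)
  finally show ?thesis .
qed

text \<open>Since \<open>h\<close> vanishes on \<open>B\<close>, the set \<open>B\<close> and the
  nonzero level sets of \<open>h\<close> form a finite disjoint family of bounded sets, whose counts
  are independent. The exponential is a function of the counts of the level sets only.\<close>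

lemma nn_integral_poisson_indep:
  fixes \<phi> :: "ennreal \<Rightarrow> ennreal"
  assumes P: "poisson_law \<nu> P" and B: "B \<in> sets borel" "bounded B"
    and h: "h \<in> BM_plus" "finite (range h)" and hB: "\<And>x. x \<in> B \<Longrightarrow> h x = 0"
    and \<phi>: "\<phi> \<in> borel_measurable borel"
  shows "(\<integral>\<^sup>+N. \<phi> (emeasure N B) * ennreal (exp_neg (\<integral>\<^sup>+x. ennreal (h x) \<partial>N)) \<partial>P) =
    (\<integral>\<^sup>+N. \<phi> (emeasure N B) \<partial>P) * (\<integral>\<^sup>+N. ennreal (exp_neg (\<integral>\<^sup>+x. ennreal (h x) \<partial>N)) \<partial>P)"
proof -
  interpret prob_space P by (rule poisson_law_prob_space[OF P])
  define R where "R = range h - {0}"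
  have "finite R" using h(2) by (simp add: R_def)
  then obtain e where e: "bij_betw e {1..card R} R"
    using ex_bij_betw_nat_finite_1 by blast
  define I where "I = {1..card R}"
  \<comment> \<open>\<open>poisson_law\<close> indexes its families by natural numbers: the index 0
    is reserved for \<open>B\<close>, and the nonzero values of \<open>h\<close> are enumerated from
    1 on.\<close>
  define A where "A i = (if i = 0 then B else h -` {e i})" for i
  have e_inj: "inj_on e I" and e_R: "e ` I = R"
    using e by (auto simp: bij_betw_def I_def)
  have e_in: "e i \<in> R" if "i \<in> I" for i
    using e_R that by blast
  have [simp]: "0 \<notin> I" "finite I" by (auto simp: I_def)
  have A: "A i \<in> sets borel \<and> bounded (A i)" if "i \<in> insert 0 I" for i
  proof (cases "i = 0")
    case False
    then have "e i \<noteq> 0" using that e_in R_def by auto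
    then have "h -` {e i} \<subseteq> {x. h x \<noteq> 0}" by auto
    moreover have "h -` {e i} \<in> sets borel"
      using measurable_sets[OF BM_plusD(1)[OF h(1)], of "{e i}"] by simp
    ultimately show ?thesis
      using False BM_plusD(3)[OF h(1)] by (auto simp: A_def intro: bounded_subset)
  qed (use B in \<open>simp add: A_def\<close>)
  have "disjoint_family_on A (insert 0 I)"
    unfolding disjoint_family_on_def
  proof (intro ballI impI)
    fix i j assume ij: "i \<in> insert 0 I" "j \<in> insert 0 I" "i \<noteq> j"
    have *: "B \<inter> h -` {e i} = {}" if "i \<in> I" for i
      using e_in[OF that] hB by (auto simp: R_def)
    show "A i \<inter> A j = {}"
    proof (cases "i = 0 \<or> j = 0")
      case True
      with ij * show ?thesis by (auto simp: A_def)
    next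
      case False
      with ij inj_onD[OF e_inj, of i j] show ?thesis by (auto simp: A_def)
    qed
  qed
  moreover have "A ` insert 0 I \<subseteq> {B \<in> sets borel. bounded B}"
    using A by auto
  ultimately have indep: "indep_vars (\<lambda>_. borel) (\<lambda>i N. emeasure N (A i)) (insert 0 I)"
    using P unfolding poisson_law_def by (meson \<open>finite I\<close> finite.insertI)
  define g where "g i s = (if i = 0 then \<phi> s else ennreal (exp_neg (ennreal (e i) * s)))" for i :: nat and s
  have g: "g i \<in> borel_measurable borel" for i
    unfolding g_def using \<phi> by (cases "i = 0") simp_all
  have indep_g: "indep_vars (\<lambda>_. borel) (\<lambda>i N. g i (emeasure N (A i))) (insert 0 I)"
    by (rule indep_vars_compose2[OF indep g])
  have exp_h: "ennreal (exp_neg (\<integral>\<^sup>+x. ennreal (h x) \<partial>N)) = (\<Prod>i\<in>I. g i (emeasure N (A i)))"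
    if "N \<in> space P" for N
  proof -
    have N: "N \<in> bfm_set" using that poisson_law_space[OF P] by simp
    have "(\<integral>\<^sup>+x. ennreal (h x) \<partial>N) = (\<Sum>s\<in>R. ennreal s * emeasure N (h -` {s}))"
      unfolding R_def by (rule nn_integral_simple_bfm[OF N h])
    also have "\<dots> = (\<Sum>i\<in>I. ennreal (e i) * emeasure N (h -` {e i}))"
      unfolding e_R[symmetric] by (simp add: sum.reindex[OF e_inj])
    also have "ennreal (exp_neg \<dots>) = (\<Prod>i\<in>I. ennreal (exp_neg (ennreal (e i) * emeasure N (h -` {e i}))))"
      by (simp add: exp_neg_sum prod_ennreal)
    also have "\<dots> = (\<Prod>i\<in>I. g i (emeasure N (A i)))"
      using \<open>0 \<notin> I\<close> by (intro prod.cong refl) (auto simp: g_def A_def)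
    finally show ?thesis .
  qed
  have "(\<integral>\<^sup>+N. \<phi> (emeasure N B) * ennreal (exp_neg (\<integral>\<^sup>+x. ennreal (h x) \<partial>N)) \<partial>P) =
      (\<integral>\<^sup>+N. (\<Prod>i\<in>insert 0 I. g i (emeasure N (A i))) \<partial>P)"
    by (intro nn_integral_cong) (simp add: exp_h, simp add: g_def A_def)
  also have "\<dots> = (\<Prod>i\<in>insert 0 I. \<integral>\<^sup>+N. g i (emeasure N (A i)) \<partial>P)"
    by (intro indep_vars_nn_integral indep_g) auto
  also have "\<dots> = (\<integral>\<^sup>+N. \<phi> (emeasure N B) \<partial>P) * (\<Prod>i\<in>I. \<integral>\<^sup>+N. g i (emeasure N (A i)) \<partial>P)"
    by simp (simp add: g_def A_def)
  also have "(\<Prod>i\<in>I. \<integral>\<^sup>+N. g i (emeasure N (A i)) \<partial>P) = (\<integral>\<^sup>+N. (\<Prod>i\<in>I. g i (emeasure N (A i))) \<partial>P)"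
    by (rule indep_vars_nn_integral[OF _ indep_vars_subset[OF indep_g], symmetric]) auto
  also have "\<dots> = (\<integral>\<^sup>+N. ennreal (exp_neg (\<integral>\<^sup>+x. ennreal (h x) \<partial>N)) \<partial>P)"
    by (intro nn_integral_cong) (simp add: exp_h)
  finally show ?thesis .
qed

text \<open>On \<open>B\<close> the function equals \<open>r\<close>, so \<open>N f\<close> is
  \<open>r\<close> times the count of \<open>B\<close> plus the integral of the part
  \<open>h\<close> off \<open>B\<close>. Independence isolates the count, the size-biased identity
  for one Poisson variable treats it, and independence used backwards reassembles the exponential of
  \<open>N f\<close>.\<close>

lemma nn_integral_poisson_level:
  fixes f :: "'a::polish_space \<Rightarrow> real"
  assumes \<nu>: "\<nu> \<in> bfm_set" and P: "poisson_law \<nu> P" and B: "B \<in> sets borel" "bounded B"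
    and f: "f \<in> BM_plus" "finite (range f)" and fB: "\<And>x. x \<in> B \<Longrightarrow> f x = r" and r: "0 \<le> r"
  shows "(\<integral>\<^sup>+N. emeasure N B * ennreal (exp_neg (\<integral>\<^sup>+x. ennreal (f x) \<partial>N)) \<partial>P) =
    ennreal (exp (- r)) * emeasure \<nu> B * (\<integral>\<^sup>+N. ennreal (exp_neg (\<integral>\<^sup>+x. ennreal (f x) \<partial>N)) \<partial>P)"
proof -
  define h where "h x = f x * indicator (- B) x" for x
  have h: "h \<in> BM_plus" "finite (range h)" "\<And>x. x \<in> B \<Longrightarrow> h x = 0"
  proof -
    have "h \<in> borel_measurable borel"
      unfolding h_def using BM_plusD(1)[OF f(1)] B(1)
      by (intro borel_measurable_times borel_measurable_indicator) auto
    then show "h \<in> BM_plus"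
      using f(1) by (auto simp: BM_plus_def h_def indicator_def intro: bounded_subset)
    have "range h \<subseteq> insert 0 (range f)" by (auto simp: h_def indicator_def)
    then show "finite (range h)" using f(2) by (auto intro: finite_subset)
  qed (simp add: h_def)
  have split: "ennreal (exp_neg (\<integral>\<^sup>+x. ennreal (f x) \<partial>N)) =
      ennreal (exp_neg (ennreal r * emeasure N B)) * ennreal (exp_neg (\<integral>\<^sup>+x. ennreal (h x) \<partial>N))"
    if "N \<in> space P" for N
  proof -
    have N: "N \<in> bfm_set" using that poisson_law_space[OF P] by simp
    have [measurable]: "B \<in> sets N" "h \<in> borel_measurable N"
      using B(1) BM_plusD(1)[OF h(1)] measurable_cong_sets[OF sets_bfm_set[OF N] refl]
      by (auto simp: sets_bfm_set[OF N])
    have "(\<integral>\<^sup>+x. ennreal (f x) \<partial>N) = (\<integral>\<^sup>+x. ennreal r * indicator B x + ennreal (h x) \<partial>N)"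
      using fB by (intro nn_integral_cong) (auto simp: h_def indicator_def)
    also have "\<dots> = ennreal r * emeasure N B + (\<integral>\<^sup>+x. ennreal (h x) \<partial>N)"
      by (subst nn_integral_add) (auto simp: nn_integral_cmult_indicator)
    finally show ?thesis by (simp add: exp_neg_add ennreal_mult)
  qed
  note indep = nn_integral_poisson_indep[OF P B h]
  have "(\<integral>\<^sup>+N. emeasure N B * ennreal (exp_neg (\<integral>\<^sup>+x. ennreal (f x) \<partial>N)) \<partial>P) =
      (\<integral>\<^sup>+N. emeasure N B * ennreal (exp_neg (ennreal r * emeasure N B)) *
        ennreal (exp_neg (\<integral>\<^sup>+x. ennreal (h x) \<partial>N)) \<partial>P)"
    by (intro nn_integral_cong) (simp add: split mult.assoc)
  also have "\<dots> = ennreal (exp (- r)) * emeasure \<nu> B *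
      ((\<integral>\<^sup>+N. ennreal (exp_neg (ennreal r * emeasure N B)) \<partial>P) *
       (\<integral>\<^sup>+N. ennreal (exp_neg (\<integral>\<^sup>+x. ennreal (h x) \<partial>N)) \<partial>P))"
    using indep[of "\<lambda>s. s * ennreal (exp_neg (ennreal r * s))"]
    by (simp add: nn_integral_poisson_size_bias[OF \<nu> P B r] mult.assoc)
  \<comment> \<open>Independence is now read from right to left, with the count of \<open>B\<close>
    entering only through its exponential.\<close>
  also have "(\<integral>\<^sup>+N. ennreal (exp_neg (ennreal r * emeasure N B)) \<partial>P) *
       (\<integral>\<^sup>+N. ennreal (exp_neg (\<integral>\<^sup>+x. ennreal (h x) \<partial>N)) \<partial>P) =
       (\<integral>\<^sup>+N. ennreal (exp_neg (\<integral>\<^sup>+x. ennreal (f x) \<partial>N)) \<partial>P)"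
    using indep[of "\<lambda>s. ennreal (exp_neg (ennreal r * s))", symmetric]
    by (simp add: split cong: nn_integral_cong)
  finally show ?thesis .
qed

text \<open>The set \<open>B\<close> is cut into the pieces \<open>L r\<close> on which
  \<open>f\<close> has the value \<open>r\<close>. Here the value 0 is included: the pieces are
  bounded because \<open>B\<close> is. Summing the factors \<open>exp (- r)\<close> times the masses
  of the pieces gives the integral of \<open>exp (- f x)\<close> over \<open>B\<close>.\<close>

lemma nn_integral_poisson_mecke_exp:
  fixes f :: "'a::polish_space \<Rightarrow> real"
  assumes \<nu>: "\<nu> \<in> bfm_set" and P: "poisson_law \<nu> P" and B: "B \<in> sets borel" "bounded B"
    and f: "f \<in> BM_plus" "finite (range f)"
  shows "(\<integral>\<^sup>+N. emeasure N B * ennreal (exp_neg (\<integral>\<^sup>+x. ennreal (f x) \<partial>N)) \<partial>P) =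
    (\<integral>\<^sup>+x. ennreal (exp (- f x)) * indicator B x \<partial>\<nu>) *
    (\<integral>\<^sup>+N. ennreal (exp_neg (\<integral>\<^sup>+x. ennreal (f x) \<partial>N)) \<partial>P)"
proof -
  define L where "L r = B \<inter> f -` {r}" for r
  have L: "L r \<in> sets borel" "bounded (L r)" for r
    using B measurable_sets[OF BM_plusD(1)[OF f(1)], of "{r}"]
    by (auto simp: L_def intro: bounded_subset)
  have sum_L: "emeasure N B = (\<Sum>r\<in>range f. emeasure N (L r))" if "N \<in> bfm_set" for N
  proof -
    have "(\<Sum>r\<in>range f. emeasure N (L r)) = emeasure N (\<Union>r\<in>range f. L r)"
      using L f(2) by (intro sum_emeasure) (auto simp: sets_bfm_set[OF that] disjoint_family_on_def L_def)
    also have "(\<Union>r\<in>range f. L r) = B" by (auto simp: L_def)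
    finally show ?thesis ..
  qed
  note [measurable] = L(1) measurable_exp_neg_nn_integral[OF f(1)]
  let ?E = "\<lambda>N. ennreal (exp_neg (\<integral>\<^sup>+x. ennreal (f x) \<partial>N))"
  have "(\<integral>\<^sup>+N. emeasure N B * ?E N \<partial>P) = (\<integral>\<^sup>+N. (\<Sum>r\<in>range f. emeasure N (L r) * ?E N) \<partial>P)"
    by (intro nn_integral_cong) (simp add: sum_L poisson_law_space[OF P] sum_distrib_right)
  also have "\<dots> = (\<Sum>r\<in>range f. \<integral>\<^sup>+N. emeasure N (L r) * ?E N \<partial>P)"
    by (intro nn_integral_sum) (simp add: measurable_poisson_law[OF P])
  also have "\<dots> = (\<Sum>r\<in>range f. ennreal (exp (- r)) * emeasure \<nu> (L r) * (\<integral>\<^sup>+N. ?E N \<partial>P))"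
    using BM_plusD(2)[OF f(1)]
    by (intro sum.cong refl nn_integral_poisson_level[OF \<nu> P L f]) (auto simp: L_def)
  also have "\<dots> = (\<Sum>r\<in>range f. \<integral>\<^sup>+x. ennreal (exp (- r)) * indicator (L r) x \<partial>\<nu>) * (\<integral>\<^sup>+N. ?E N \<partial>P)"
    using L(1) by (simp add: sum_distrib_right nn_integral_cmult_indicator sets_bfm_set[OF \<nu>])
  also have "(\<Sum>r\<in>range f. \<integral>\<^sup>+x. ennreal (exp (- r)) * indicator (L r) x \<partial>\<nu>) =
      (\<integral>\<^sup>+x. (\<Sum>r\<in>range f. ennreal (exp (- r)) * indicator (L r) x) \<partial>\<nu>)"
    using L(1) by (intro nn_integral_sum[symmetric] borel_measurable_times_ennreal borel_measurable_const
        borel_measurable_indicator) (simp add: sets_bfm_set[OF \<nu>])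
  also have "\<dots> = (\<integral>\<^sup>+x. ennreal (exp (- f x)) * indicator B x \<partial>\<nu>)"
  proof (rule nn_integral_cong)
    fix x
    have "(\<Sum>r\<in>range f. ennreal (exp (- r)) * indicator (L r) x) =
        (\<Sum>r\<in>range f. if r = f x then ennreal (exp (- r)) * indicator B x else 0)"
      by (intro sum.cong) (auto simp: L_def indicator_def)
    then show "(\<Sum>r\<in>range f. ennreal (exp (- r)) * indicator (L r) x) =
        ennreal (exp (- f x)) * indicator B x"
      using f(2) by simp
  qed
  finally show ?thesis .
qed

section \<open>From exponentials to all integrands\<close>

lemma nn_integral_add_dirac_BM_plus:
  assumes "N \<in> bfm_set" "finite S" "f \<in> BM_plus"
  shows "exp_neg (\<integral>\<^sup>+x. ennreal (f x) \<partial>add_dirac N S) =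
    exp_neg (\<integral>\<^sup>+x. ennreal (f x) \<partial>N) * (\<Prod>x\<in>S. exp (- f x))"
  using assms BM_plusD[OF assms(3)]
  by (simp add: nn_integral_add_dirac exp_neg_add exp_neg_sum del: sum_ennreal)

lemma measurable_add_dirac_single [measurable]:
  "(\<lambda>(x, N). add_dirac N {x}) \<in> measurable (borel \<Otimes>\<^sub>M bfm) (bfm :: 'a::polish_space measure measure)"
proof (rule measurable_bfmI)
  fix A :: "'a set" assume A [measurable]: "A \<in> sets borel"
  have "(\<lambda>z. emeasure (snd z) A + indicator A (fst z)) \<in> borel_measurable (borel \<Otimes>\<^sub>M bfm)"
    using measurable_compose[OF measurable_snd measurable_emeasure_bfm[OF A]] by measurable
  then show "(\<lambda>z. emeasure (case z of (x, N) \<Rightarrow> add_dirac N {x}) A) \<in> borel_measurable (borel \<Otimes>\<^sub>M bfm)"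
    by (rule measurable_cong[THEN iffD1, rotated])
       (use A in \<open>auto simp: space_pair_measure emeasure_add_dirac bfm_setD\<close>)
qed (auto simp: space_pair_measure intro!: add_dirac_bfm)

lemma laplace_eq_enn2real:
  assumes "sets Q = sets bfm" "f \<in> BM_plus"
  shows "laplace Q f = enn2real (\<integral>\<^sup>+N. ennreal (exp_neg (\<integral>\<^sup>+x. ennreal (f x) \<partial>N)) \<partial>Q)"
  unfolding laplace_def using measurable_exp_neg_nn_integral[OF assms(2)]
  by (intro integral_eq_nn_integral) (simp_all add: measurable_cong_sets[OF assms(1) refl])

text \<open>This is the exponential formula at \<open>f = 0\<close>. It supplies the finiteness of
  the measures compared below.\<close>

lemma nn_integral_poisson_mean:
  assumes \<nu>: "\<nu> \<in> bfm_set" and P: "poisson_law \<nu> P" and B: "B \<in> sets borel" "bounded B"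
  shows "(\<integral>\<^sup>+N. emeasure N B \<partial>P) = emeasure \<nu> B"
proof -
  interpret prob_space P by (rule poisson_law_prob_space[OF P])
  show ?thesis
    using nn_integral_poisson_mecke_exp[OF \<nu> P B BM_plus_0] B(1)
    by (simp add: sets_bfm_set[OF \<nu>] emeasure_space_1)
qed

text \<open>As functions of \<open>D\<close>, both sides are measures of total mass
  \<open>emeasure \<nu> B\<close>, which is finite because \<open>B\<close> is bounded. It is
  therefore enough to compare Laplace functionals: that of \<open>P\<close> weighted by the count of
  \<open>B\<close>, and that of the mixture over \<open>x\<close> in \<open>B\<close> of the laws of
  \<open>N\<close> with a point added at \<open>x\<close>.\<close>

lemma nn_integral_poisson_mecke_rectangle:
  fixes \<nu> :: "'a::polish_space measure"
  assumes \<nu>: "\<nu> \<in> bfm_set" and P: "poisson_law \<nu> P" and B: "B \<in> sets borel" "bounded B"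
    and D: "D \<in> sets bfm"
  shows "(\<integral>\<^sup>+N. emeasure N B * indicator D N \<partial>P) =
    (\<integral>\<^sup>+x. indicator B x * (\<integral>\<^sup>+N. indicator D (add_dirac N {x}) \<partial>P) \<partial>\<nu>)"
proof -
  interpret prob_space P by (rule poisson_law_prob_space[OF P])
  note setsP [measurable_cong] = poisson_law_sets[OF P]
  note sets\<nu> [measurable_cong] = sets_bfm_set[OF \<nu>]
  note [measurable] = B(1)
  have [measurable]: "(\<lambda>N. emeasure N B) \<in> borel_measurable P"
    using B(1) by (simp add: measurable_poisson_law[OF P])
  define \<kappa> where "\<kappa> x = distr P bfm (\<lambda>N. add_dirac N {x})" for x
  have add [measurable]: "(\<lambda>N. add_dirac N {x}) \<in> measurable P bfm" for x
    by (simp add: measurable_poisson_law[OF P])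
  have \<kappa>: "(\<integral>\<^sup>+N. h N \<partial>\<kappa> x) = (\<integral>\<^sup>+N. h (add_dirac N {x}) \<partial>P)" if "h \<in> borel_measurable bfm"
    for h :: "'a measure \<Rightarrow> ennreal" and x
    unfolding \<kappa>_def using that by (intro nn_integral_distr) simp_all
  have \<kappa>_meas: "(\<lambda>x. emeasure (\<kappa> x) A) \<in> borel_measurable borel" if A [measurable]: "A \<in> sets bfm" for A
  proof -
    have "(\<lambda>z. indicator A (add_dirac (snd z) {fst z}) :: ennreal) \<in> borel_measurable (borel \<Otimes>\<^sub>M P)"
      using measurable_add_dirac_single[where 'a = 'a] by (simp add: case_prod_beta)
    then have "(\<lambda>x. \<integral>\<^sup>+N. indicator A (add_dirac N {x}) \<partial>P) \<in> borel_measurable borel"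
      using borel_measurable_nn_integral[of "\<lambda>x N. indicator A (add_dirac N {x})" borel]
      by (simp add: case_prod_beta)
    moreover have "emeasure (\<kappa> x) A = (\<integral>\<^sup>+N. indicator A (add_dirac N {x}) \<partial>P)" for x
      using \<kappa>[of "indicator A" x] A by (simp add: \<kappa>_def)
    ultimately show ?thesis by simp
  qed
  define Q where "Q = density P (\<lambda>N. emeasure N B)"
  define R where "R = mixture (density \<nu> (indicator B)) bfm \<kappa>"
  have sets: "sets Q = sets bfm" "sets R = sets bfm"
    by (simp_all add: Q_def R_def setsP)
  have Q: "(\<integral>\<^sup>+N. h N \<partial>Q) = (\<integral>\<^sup>+N. emeasure N B * h N \<partial>P)" if [measurable]: "h \<in> borel_measurable bfm" for h
    unfolding Q_def by (intro nn_integral_density) measurable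
  have R: "(\<integral>\<^sup>+N. h N \<partial>R) = (\<integral>\<^sup>+x. indicator B x * (\<integral>\<^sup>+N. h (add_dirac N {x}) \<partial>P) \<partial>\<nu>)"
    if h [measurable]: "h \<in> borel_measurable bfm" for h
  proof -
    have "(\<lambda>z. h (add_dirac (snd z) {fst z})) \<in> borel_measurable (borel \<Otimes>\<^sub>M P)"
      using measurable_add_dirac_single[where 'a = 'a] by (simp add: case_prod_beta)
    then have [measurable]: "(\<lambda>x. \<integral>\<^sup>+N. h (add_dirac N {x}) \<partial>P) \<in> borel_measurable borel"
      using borel_measurable_nn_integral[of "\<lambda>x N. h (add_dirac N {x})" borel]
      by (simp add: case_prod_beta)
    have "(\<integral>\<^sup>+N. h N \<partial>R) = (\<integral>\<^sup>+x. (\<integral>\<^sup>+N. h N \<partial>\<kappa> x) \<partial>density \<nu> (indicator B))"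
      unfolding R_def using \<kappa>_meas h by (intro nn_integral_mixture) (simp_all add: \<kappa>_def)
    also have "\<dots> = (\<integral>\<^sup>+x. (\<integral>\<^sup>+N. h (add_dirac N {x}) \<partial>P) \<partial>density \<nu> (indicator B))"
      by (simp add: \<kappa>[OF h])
    also have "\<dots> = (\<integral>\<^sup>+x. indicator B x * (\<integral>\<^sup>+N. h (add_dirac N {x}) \<partial>P) \<partial>\<nu>)"
      by (intro nn_integral_density) measurable
    finally show ?thesis .
  qed
  have finB: "emeasure \<nu> B \<noteq> \<infinity>"
    using emeasure_bfm_bounded[OF \<nu> B] by simp
  have "Q = R"
  proof (rule finite_measure_bfm_eqI_laplace[OF _ _ sets])
    have "emeasure Q (space Q) = (\<integral>\<^sup>+N. 1 \<partial>Q)" by simp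
    also have "\<dots> = emeasure \<nu> B"
      using Q[of "\<lambda>_. 1"] nn_integral_poisson_mean[OF \<nu> P B] by simp
    finally show "finite_measure Q" using finB by (intro finite_measureI) simp
    have "emeasure R (space R) = (\<integral>\<^sup>+N. 1 \<partial>R)" by simp
    also have "\<dots> = emeasure \<nu> B"
      using R[of "\<lambda>_. 1"] B(1) by (simp add: emeasure_space_1 sets\<nu>)
    finally show "finite_measure R" using finB by (intro finite_measureI) simp
    fix f :: "'a \<Rightarrow> real" assume f: "f \<in> BM_plus" "finite (range f)"
    let ?E = "\<lambda>N. ennreal (exp_neg (\<integral>\<^sup>+x. ennreal (f x) \<partial>N))"
    have E [measurable]: "?E \<in> borel_measurable bfm"
      using measurable_exp_neg_nn_integral[OF f(1)] by measurable
    \<comment> \<open>The added point multiplies the exponential by \<open>exp (- f x)\<close>.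
      Integrated over \<open>B\<close>, this factor gives the right side of
      \<open>nn_integral_poisson_mecke_exp\<close>.\<close>
    have shift: "(\<integral>\<^sup>+N. ?E (add_dirac N {x}) \<partial>P) = ennreal (exp (- f x)) * (\<integral>\<^sup>+N. ?E N \<partial>P)" for x
    proof -
      have "(\<integral>\<^sup>+N. ?E (add_dirac N {x}) \<partial>P) = (\<integral>\<^sup>+N. ennreal (exp (- f x)) * ?E N \<partial>P)"
        by (intro nn_integral_cong)
           (simp add: poisson_law_space[OF P] nn_integral_add_dirac_BM_plus f(1) ennreal_mult mult.commute)
      also have "\<dots> = ennreal (exp (- f x)) * (\<integral>\<^sup>+N. ?E N \<partial>P)"
        by (intro nn_integral_cmult) measurable
      finally show ?thesis .
    qed
    have [measurable]: "f \<in> borel_measurable borel" by (rule BM_plusD(1)[OF f(1)])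
    have "(\<integral>\<^sup>+N. ?E N \<partial>R) = (\<integral>\<^sup>+x. ennreal (exp (- f x)) * indicator B x * (\<integral>\<^sup>+N. ?E N \<partial>P) \<partial>\<nu>)"
      unfolding R[OF E] shift by (simp only: mult.assoc mult.left_commute)
    also have "\<dots> = (\<integral>\<^sup>+x. ennreal (exp (- f x)) * indicator B x \<partial>\<nu>) * (\<integral>\<^sup>+N. ?E N \<partial>P)"
      by (intro nn_integral_multc) measurable
    also have "\<dots> = (\<integral>\<^sup>+N. ?E N \<partial>Q)"
      unfolding Q[OF E] by (rule nn_integral_poisson_mecke_exp[OF \<nu> P B f, symmetric])
    finally show "laplace Q f = laplace R f"
      by (simp only: laplace_eq_enn2real[OF sets(1) f(1)] laplace_eq_enn2real[OF sets(2) f(1)])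
  qed
  with Q[of "indicator D"] R[of "indicator D"] D show ?thesis by simp
qed

lemma measurable_nn_integral_self:
  fixes g :: "'a::polish_space \<times> 'a measure \<Rightarrow> ennreal"
  assumes g: "g \<in> borel_measurable (borel \<Otimes>\<^sub>M bfm)"
  shows "(\<lambda>N. \<integral>\<^sup>+x. g (x, N) \<partial>N) \<in> borel_measurable bfm"
proof -
  have "(\<lambda>z. g (snd z, fst z)) \<in> borel_measurable (bfm \<Otimes>\<^sub>M borel)"
    using g by measurable
  from measurable_nn_integral_kernel[OF measurable_ident_sets[OF refl] this] show ?thesis
    by simp
qed

text \<open>The two sides are integrals of \<open>g\<close> against measures on pairs of a point and
  a configuration: \<open>L\<close> is the Campbell measure of \<open>P\<close>, and
  \<open>R\<close> adds a point distributed according to \<open>\<nu>\<close> to an independent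
  configuration. They agree, with finite values, on rectangles with bounded base, and rectangles
  over balls exhaust the space.\<close>

lemma nn_integral_poisson_mecke:
  fixes \<nu> :: "'a::polish_space measure" and g :: "'a \<times> 'a measure \<Rightarrow> ennreal"
  assumes \<nu>: "\<nu> \<in> bfm_set" and P: "poisson_law \<nu> P" and g: "g \<in> borel_measurable (borel \<Otimes>\<^sub>M bfm)"
  shows "(\<integral>\<^sup>+N. \<integral>\<^sup>+x. g (x, N) \<partial>N \<partial>P) = (\<integral>\<^sup>+x. \<integral>\<^sup>+N. g (x, add_dirac N {x}) \<partial>P \<partial>\<nu>)"
proof -
  interpret prob_space P by (rule poisson_law_prob_space[OF P])
  note setsP [measurable_cong] = poisson_law_sets[OF P]
  note sets\<nu> [measurable_cong] = sets_bfm_set[OF \<nu>]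
  let ?K = "borel \<Otimes>\<^sub>M (bfm :: 'a measure measure)"
  define \<kappa> where "\<kappa> N = distr N ?K (\<lambda>x. (x, N))" for N :: "'a measure"
  define \<eta> where "\<eta> x = distr P ?K (\<lambda>N. (x, add_dirac N {x}))" for x
  have \<kappa>: "(\<integral>\<^sup>+z. h z \<partial>\<kappa> N) = (\<integral>\<^sup>+x. h (x, N) \<partial>N)"
    if "h \<in> borel_measurable ?K" "N \<in> space P" for h N
  proof -
    have N: "N \<in> bfm_set" using that(2) poisson_law_space[OF P] by simp
    then have "(\<lambda>x. (x, N)) \<in> measurable N ?K"
      by (simp add: measurable_cong_sets[OF sets_bfm_set[OF N] refl])
    then show ?thesis
      unfolding \<kappa>_def using that(1) by (intro nn_integral_distr) simp_all
  qed
  have \<eta>: "(\<integral>\<^sup>+z. h z \<partial>\<eta> x) = (\<integral>\<^sup>+N. h (x, add_dirac N {x}) \<partial>P)"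
    if "h \<in> borel_measurable ?K" for h x
  proof -
    have "(\<lambda>N. (x, add_dirac N {x})) \<in> measurable P ?K"
      by (simp add: measurable_poisson_law[OF P])
    then show ?thesis
      unfolding \<eta>_def using that by (intro nn_integral_distr) simp_all
  qed
  have \<kappa>_meas: "(\<lambda>N. emeasure (\<kappa> N) A) \<in> borel_measurable P" if A: "A \<in> sets ?K" for A
  proof -
    have "(\<lambda>N. \<integral>\<^sup>+x. indicator A (x, N) \<partial>N :: ennreal) \<in> borel_measurable P"
      unfolding measurable_poisson_law[OF P] using A by (intro measurable_nn_integral_self) simp
    moreover have "emeasure (\<kappa> N) A = (\<integral>\<^sup>+x. indicator A (x, N) \<partial>N)" if "N \<in> space P" for N
      using \<kappa>[of "indicator A", OF _ that] A by (simp add: \<kappa>_def)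
    ultimately show ?thesis by (simp cong: measurable_cong)
  qed
  have \<eta>_meas: "(\<lambda>x. emeasure (\<eta> x) A) \<in> borel_measurable \<nu>" if A [measurable]: "A \<in> sets ?K" for A
  proof -
    have "(\<lambda>z. indicator A (fst z, add_dirac (snd z) {fst z}) :: ennreal) \<in> borel_measurable (borel \<Otimes>\<^sub>M P)"
      using measurable_add_dirac_single[where 'a = 'a] by (simp add: case_prod_beta)
    then have "(\<lambda>x. \<integral>\<^sup>+N. indicator A (x, add_dirac N {x}) \<partial>P) \<in> borel_measurable \<nu>"
      using borel_measurable_nn_integral[of "\<lambda>x N. indicator A (x, add_dirac N {x})" borel]
      by (simp add: case_prod_beta measurable_cong_sets[OF sets\<nu> refl])
    moreover have "emeasure (\<eta> x) A = (\<integral>\<^sup>+N. indicator A (x, add_dirac N {x}) \<partial>P)" for x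
      using \<eta>[of "indicator A" x] A by (simp add: \<eta>_def)
    ultimately show ?thesis by simp
  qed
  define L where "L = mixture P ?K \<kappa>"
  define R where "R = mixture \<nu> ?K \<eta>"
  have L: "(\<integral>\<^sup>+z. h z \<partial>L) = (\<integral>\<^sup>+N. \<integral>\<^sup>+x. h (x, N) \<partial>N \<partial>P)" if h: "h \<in> borel_measurable ?K" for h
    unfolding L_def using \<kappa>_meas h \<kappa>[OF h]
    by (subst nn_integral_mixture) (auto simp: \<kappa>_def cong: nn_integral_cong)
  have R: "(\<integral>\<^sup>+z. h z \<partial>R) = (\<integral>\<^sup>+x. \<integral>\<^sup>+N. h (x, add_dirac N {x}) \<partial>P \<partial>\<nu>)"
    if h: "h \<in> borel_measurable ?K" for h
    unfolding R_def using \<eta>_meas h \<eta>[OF h]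
    by (subst nn_integral_mixture) (auto simp: \<eta>_def cong: nn_integral_cong)
  have setsL: "sets L = sets ?K" and setsR: "sets R = sets ?K"
    by (simp_all add: L_def R_def)
  have bdd: "emeasure L (B \<times> D) = emeasure R (B \<times> D)"
    and fin: "emeasure L (B \<times> D) \<noteq> \<infinity>"
    if B: "B \<in> sets borel" "bounded B" and D: "D \<in> sets bfm" for B D
  proof -
    have BD: "B \<times> D \<in> sets ?K" using B D by simp
    have "emeasure L (B \<times> D) = (\<integral>\<^sup>+N. \<integral>\<^sup>+x. indicator (B \<times> D) (x, N) \<partial>N \<partial>P)"
      using L[of "indicator (B \<times> D)"] BD by (simp add: setsL)
    also have "\<dots> = (\<integral>\<^sup>+N. emeasure N B * indicator D N \<partial>P)"
    proof (rule nn_integral_cong)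
      fix N assume "N \<in> space P"
      then have "B \<in> sets N" using B poisson_law_space[OF P] by (simp add: sets_bfm_set)
      then show "(\<integral>\<^sup>+x. indicator (B \<times> D) (x, N) \<partial>N) = emeasure N B * indicator D N"
        by (simp add: indicator_times nn_integral_multc)
    qed
    finally have L_BD: "emeasure L (B \<times> D) = (\<integral>\<^sup>+N. emeasure N B * indicator D N \<partial>P)" .
    have "emeasure R (B \<times> D) = (\<integral>\<^sup>+x. \<integral>\<^sup>+N. indicator (B \<times> D) (x, add_dirac N {x}) \<partial>P \<partial>\<nu>)"
      using R[of "indicator (B \<times> D)"] BD by (simp add: setsR)
    also have "\<dots> = (\<integral>\<^sup>+x. indicator B x * (\<integral>\<^sup>+N. indicator D (add_dirac N {x}) \<partial>P) \<partial>\<nu>)"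
      by (intro nn_integral_cong) (auto simp: indicator_times indicator_def)
    finally show "emeasure L (B \<times> D) = emeasure R (B \<times> D)"
      using L_BD nn_integral_poisson_mecke_rectangle[OF \<nu> P B D] by simp
    have "emeasure L (B \<times> D) \<le> (\<integral>\<^sup>+N. emeasure N B \<partial>P)"
      unfolding L_BD by (intro nn_integral_mono) (auto simp: indicator_def)
    also have "\<dots> < \<infinity>"
      using nn_integral_poisson_mean[OF \<nu> P B] emeasure_bfm_bounded[OF \<nu> B] by simp
    finally show "emeasure L (B \<times> D) \<noteq> \<infinity>" by simp
  qed
  have UN_times: "(\<Union>n. C n \<times> D) = (\<Union>n. C n) \<times> D" for C :: "nat \<Rightarrow> 'a set" and D :: "'a measure set"
    by blast
  have "L = R"
  proof (rule measure_eqI_generator_eq[OF Int_stable_pair_measure_generator[of borel "bfm :: 'a measure measure"],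
        where \<Omega> = "UNIV \<times> bfm_set" and A = "\<lambda>n. ball undefined (real n) \<times> bfm_set"])
    show "{a \<times> b | a b. a \<in> sets borel \<and> b \<in> sets (bfm :: 'a measure measure)} \<subseteq> Pow (UNIV \<times> bfm_set)"
      using sets.sets_into_space[of _ bfm] by auto
    show "sets L = sigma_sets (UNIV \<times> bfm_set) {a \<times> b | a b. a \<in> sets borel \<and> b \<in> sets bfm}"
      "sets R = sigma_sets (UNIV \<times> bfm_set) {a \<times> b | a b. a \<in> sets borel \<and> b \<in> sets bfm}"
      by (simp_all add: setsL setsR sets_pair_measure)
    have top: "bfm_set \<in> sets (bfm :: 'a measure measure)"
      using sets.top[of "bfm :: 'a measure measure"] by simp
    show "range (\<lambda>n. ball undefined (real n) \<times> bfm_set) \<subseteq>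
        {a \<times> b | a b. a \<in> sets borel \<and> b \<in> sets (bfm :: 'a measure measure)}"
      using top by (intro image_subsetI CollectI exI conjI refl) auto
    show "(\<Union>n. ball (undefined :: 'a) (real n) \<times> bfm_set) = UNIV \<times> (bfm_set :: 'a measure set)"
      by (simp only: UN_times UN_ball_nat)
    show "emeasure L (ball undefined (real n) \<times> bfm_set) \<noteq> \<infinity>" for n
      by (intro fin top) auto
    fix X assume "X \<in> {a \<times> b | a b. a \<in> sets (borel :: 'a measure) \<and> b \<in> sets (bfm :: 'a measure measure)}"
    then obtain a b where X: "X = a \<times> b" and a: "a \<in> sets borel" and b: "b \<in> sets bfm" by auto
    \<comment> \<open>The generator also contains rectangles with unbounded base, where both masses
      may be infinite; these are limits of rectangles with bounded base.\<close>
    have SUP: "emeasure S X = (SUP n. emeasure S ((a \<inter> ball undefined (real n)) \<times> b))"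
      if "sets S = sets ?K" for S
    proof -
      have "(SUP n. emeasure S ((a \<inter> ball undefined (real n)) \<times> b)) =
          emeasure S (\<Union>n. (a \<inter> ball undefined (real n)) \<times> b)"
      proof (rule SUP_emeasure_incseq)
        show "range (\<lambda>n. (a \<inter> ball undefined (real n)) \<times> b) \<subseteq> sets S"
          unfolding that using a b by (intro image_subsetI pair_measureI sets.Int) auto
        show "incseq (\<lambda>n. (a \<inter> ball undefined (real n)) \<times> b)"
          unfolding incseq_def by (intro allI impI Sigma_mono Int_mono subset_ball order_refl) simp
      qed
      also have "(\<Union>n. (a \<inter> ball undefined (real n)) \<times> b) = X"
        by (simp only: X UN_times Int_UN_distrib[symmetric] UN_ball_nat Int_UNIV_right)
      finally show ?thesis ..
    qed
    have "emeasure L ((a \<inter> ball undefined (real n)) \<times> b) = emeasure R ((a \<inter> ball undefined (real n)) \<times> b)" for n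
      using a b by (intro bdd) (auto intro: bounded_subset[OF bounded_ball])
    then show "emeasure L X = emeasure R X"
      unfolding SUP[OF setsL] SUP[OF setsR] by simp
  qed
  with L[OF g] R[OF g] show ?thesis by simp
qed

section \<open>Partitions and the sequential measure\<close>

lemma cell_of_eq:
  assumes "partition_on A p" "C \<in> p" "i \<in> C"
  shows "cell_of p i = C"
  unfolding cell_of_def
  using assms partition_onD2[OF assms(1)] by (intro the_equality) (auto simp: disjoint_def)

lemma cell_of_contains:
  assumes "partition_on A p" "i \<in> A"
  shows "i \<in> cell_of p i"
proof -
  obtain C where "C \<in> p" "i \<in> C"
    using assms partition_onD1[OF assms(1)] by auto
  with cell_of_eq[OF assms(1)] show ?thesis by simp
qed

lemma partition_on_singleton_insert:
  assumes "partition_on A p" "a \<notin> A"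
  shows "partition_on (insert a A) (insert {a} p)"
  using assms partition_onD1[OF assms(1)]
  by (subst partition_on_insert) (auto simp: disjnt_def)

lemma partition_on_extend_cell:
  assumes p: "partition_on A p" and a: "a \<notin> A" and C: "C \<in> p"
  shows "partition_on (insert a A) (insert (insert a C) (p - {C}))"
proof (rule partition_onI)
  have "C \<union> \<Union>(p - {C}) = A"
    using partition_onD1[OF p] C by auto
  then show "\<Union>(insert (insert a C) (p - {C})) = insert a A" by auto
  show "disjnt X Y" if "X \<in> insert (insert a C) (p - {C})" "Y \<in> insert (insert a C) (p - {C})" "X \<noteq> Y" for X Y
    using that partition_onD1[OF p] partition_onD2[OF p] C a by (auto simp: disjoint_def disjnt_def)
  show "{} \<notin> insert (insert a C) (p - {C})"
    using partition_onD3[OF p] by auto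
qed

text \<open>Deleting \<open>a\<close> from a partition \<open>q\<close> of \<open>insert a A\<close>
  is invertible once it is recorded where \<open>a\<close> was. Either \<open>{a}\<close> is a cell,
  and dropping it leaves a partition \<open>p\<close> of \<open>A\<close>; or the cell of
  \<open>a\<close> shrinks to a nonempty cell \<open>C\<close>, and \<open>q\<close> corresponds to
  the pair of \<open>p\<close> and its marked cell \<open>C\<close>.\<close>

lemma sum_partition_on_insert:
  fixes A :: "nat set" and F :: "nat set set \<Rightarrow> 'c::comm_monoid_add"
  assumes A: "finite A" and a: "a \<notin> A"
  shows "(\<Sum>q | partition_on (insert a A) q. F q) =
    (\<Sum>p | partition_on A p. F (insert {a} p) + (\<Sum>C\<in>p. F (insert (insert a C) (p - {C}))))"
proof -
  define S where "S = {q. partition_on (insert a A) q}"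
  define T where "T = {p. partition_on A p}"
  have fin: "finite S" "finite T"
    unfolding S_def T_def using A by (auto intro: finitely_many_partition_on)
  have finp: "finite p" if "p \<in> T" for p
    using that A finite_elements by (auto simp: T_def)
  have a_notin: "a \<notin> C" if "C \<in> p" "p \<in> T" for C p
    using that a partition_onD1[of A p] by (auto simp: T_def)
  have "sum F {q\<in>S. {a} \<in> q} = (\<Sum>p\<in>T. F (insert {a} p))"
  proof (rule sum.reindex_bij_witness[where S = "{q\<in>S. {a} \<in> q}" and T = T and g = F
        and h = "\<lambda>p. F (insert {a} p)" and j = "\<lambda>q. q - {{a}}" and i = "insert {a}"])
    fix q assume q: "q \<in> {q\<in>S. {a} \<in> q}"
    then have part: "partition_on (insert a A) q" by (simp add: S_def)
    from q show eq: "insert {a} (q - {{a}}) = q" by auto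
    then show "F (insert {a} (q - {{a}})) = F q" by simp
    have "a \<notin> D" if "D \<in> q - {{a}}" for D
      using that q cell_of_eq[OF part, of D a] cell_of_eq[OF part, of "{a}" a] by auto
    then have "disjnt {a} (\<Union>(q - {{a}}))"
      by (auto simp: disjnt_def)
    from partition_on_insert[OF this, of "insert a A"] part eq a show "q - {{a}} \<in> T"
      by (simp add: T_def)
  next
    fix p assume p: "p \<in> T"
    then show "insert {a} p - {{a}} = p"
      using a_notin[of "{a}" p] by auto
    show "insert {a} p \<in> {q\<in>S. {a} \<in> q}"
      using p a by (simp add: S_def T_def partition_on_singleton_insert)
  qed
  moreover have "sum F {q\<in>S. {a} \<notin> q} = (\<Sum>(p, C)\<in>Sigma T (\<lambda>p. p). F (insert (insert a C) (p - {C})))"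
  proof (rule sum.reindex_bij_witness[
        where S = "{q\<in>S. {a} \<notin> q}" and T = "Sigma T (\<lambda>p. p)" and g = F
          and h = "\<lambda>(p, C). F (insert (insert a C) (p - {C}))"
          and j = "\<lambda>q. (insert (cell_of q a - {a}) (q - {cell_of q a}), cell_of q a - {a})"
          and i = "\<lambda>(p, C). insert (insert a C) (p - {C})"])
    fix q assume q: "q \<in> {q\<in>S. {a} \<notin> q}"
    then have part: "partition_on (insert a A) q" by (simp add: S_def)
    define D where "D = cell_of q a"
    have D: "D \<in> q" "a \<in> D"
      unfolding D_def by (auto intro: cell_of_in[OF part] cell_of_contains[OF part])
    have disj: "X \<inter> D = {}" if "X \<in> q" "X \<noteq> D" for X
      using that D(1) partition_onD2[OF part] by (auto simp: disjoint_def)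
    have "D \<noteq> {a}" using q D by auto
    with D have ne: "D - {a} \<noteq> {}" by auto
    \<comment> \<open>Being nonempty, \<open>D - {a}\<close> meets \<open>D\<close> and so cannot be
      another cell of \<open>q\<close>. Hence enlarging it again restores \<open>q\<close> without
      removing a second cell.\<close>
    then have "D - {a} \<notin> q - {D}" using disj by blast
    then have eq: "insert (insert a (D - {a})) (insert (D - {a}) (q - {D}) - {D - {a}}) = q"
      using D by (auto simp: insert_absorb)
    show "(\<lambda>(p, C). insert (insert a C) (p - {C}))
        (insert (cell_of q a - {a}) (q - {cell_of q a}), cell_of q a - {a}) = q"
      using eq by (simp add: D_def)
    then show "(case (insert (cell_of q a - {a}) (q - {cell_of q a}), cell_of q a - {a}) of
        (p, C) \<Rightarrow> F (insert (insert a C) (p - {C}))) = F q"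
      by simp
    have "partition_on A (insert (D - {a}) (q - {D}))"
    proof (rule partition_onI)
      have "\<Union>q = D \<union> \<Union>(q - {D})" using D by auto
      moreover have "a \<notin> \<Union>(q - {D})" using disj D by auto
      ultimately show "\<Union>(insert (D - {a}) (q - {D})) = A"
        using partition_onD1[OF part] a by auto
      show "disjnt X Y" if "X \<in> insert (D - {a}) (q - {D})" "Y \<in> insert (D - {a}) (q - {D})" "X \<noteq> Y" for X Y
        using that disj partition_onD2[OF part] unfolding disjoint_def disjnt_def by blast
      show "{} \<notin> insert (D - {a}) (q - {D})"
        using ne partition_onD3[OF part] by auto
    qed
    then show "(insert (cell_of q a - {a}) (q - {cell_of q a}), cell_of q a - {a}) \<in> Sigma T (\<lambda>p. p)"
      by (simp add: T_def D_def)
  next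
    fix pC assume pC: "pC \<in> Sigma T (\<lambda>p. p)"
    obtain p C where [simp]: "pC = (p, C)" by (cases pC)
    have p: "p \<in> T" "partition_on A p" and C: "C \<in> p" using pC by (auto simp: T_def)
    define q where "q = insert (insert a C) (p - {C})"
    have part: "partition_on (insert a A) q"
      unfolding q_def by (rule partition_on_extend_cell[OF p(2) a C])
    have cell: "cell_of q a = insert a C"
      by (rule cell_of_eq[OF part]) (auto simp: q_def)
    have Ca: "insert a C - {a} = C" using a_notin[OF C p(1)] by auto
    have "insert a C \<notin> p" using a_notin[OF _ p(1)] by blast
    then have "insert C (q - {insert a C}) = p" using C by (auto simp: q_def)
    then show "(insert (cell_of ((\<lambda>(p, C). insert (insert a C) (p - {C})) pC) a - {a})
        ((\<lambda>(p, C). insert (insert a C) (p - {C})) pC - {cell_of ((\<lambda>(p, C). insert (insert a C) (p - {C})) pC) a}),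
        cell_of ((\<lambda>(p, C). insert (insert a C) (p - {C})) pC) a - {a}) = pC"
      using cell Ca by (simp add: q_def)
    have "{a} \<notin> q"
    proof
      assume "{a} \<in> q"
      then have "insert a C = {a}" using a_notin[OF _ p(1)] by (auto simp: q_def)
      with Ca partition_onD3[OF p(2)] C show False by auto
    qed
    with part show "(\<lambda>(p, C). insert (insert a C) (p - {C})) pC \<in> {q\<in>S. {a} \<notin> q}"
      by (simp add: S_def q_def)
  qed
  moreover have "sum F S = sum F {q\<in>S. {a} \<in> q} + sum F {q\<in>S. {a} \<notin> q}"
    using fin(1) by (subst sum.union_disjoint[symmetric]) (auto intro!: sum.cong)
  moreover have "(\<Sum>(p, C)\<in>Sigma T (\<lambda>p. p). F (insert (insert a C) (p - {C}))) =
      (\<Sum>p\<in>T. \<Sum>C\<in>p. F (insert (insert a C) (p - {C})))"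
    using fin finp by (subst sum.Sigma) auto
  ultimately show ?thesis
    by (simp add: S_def[symmetric] T_def[symmetric] sum.distrib)
qed

section \<open>Vectors with prescribed ties\<close>

lemma expand_outside: "i \<notin> {1..n} \<Longrightarrow> expand n p w i = undefined"
  unfolding expand_def by (simp only: restrict_apply if_False)

text \<open>The new coordinate forms a cell with a free value of its own, and the old cells keep
  their names and thus their values.\<close>

lemma expand_singleton_cell:
  assumes p: "partition_on {1..m} p"
  shows "expand (Suc m) (insert {Suc m} p) (w({Suc m} := x)) = (expand m p w)(Suc m := x)"
proof
  fix i
  have q: "partition_on {1..Suc m} (insert {Suc m} p)"
    using partition_on_singleton_insert[OF p, of "Suc m"] by (simp add: atLeastAtMostSuc_conv)
  consider "i = Suc m" | "i \<in> {1..m}" | "i \<notin> {1..Suc m}"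
    by (force simp: atLeastAtMostSuc_conv)
  then show "expand (Suc m) (insert {Suc m} p) (w({Suc m} := x)) i = ((expand m p w)(Suc m := x)) i"
  proof cases
    case 1
    then show ?thesis
      using cell_of_eq[OF q, of "{Suc m}" "Suc m"] by (simp add: expand_def)
  next
    case 2
    have C: "cell_of p i \<in> p" "i \<in> cell_of p i"
      using cell_of_in[OF p 2] cell_of_contains[OF p 2] by auto
    then have "cell_of (insert {Suc m} p) i = cell_of p i"
      using cell_of_eq[OF q] by simp
    moreover have "cell_of p i \<noteq> {Suc m}"
    proof
      assume "cell_of p i = {Suc m}"
      with C(2) have "i = Suc m" by simp
      with 2 show False by simp
    qed
    ultimately show ?thesis
      using 2 by (simp add: expand_def)
  next
    case 3
    then have "i \<noteq> Suc m" "i \<notin> {1..m}" by auto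
    with 3 show ?thesis by (simp add: expand_outside del: atLeastAtMost_iff)
  qed
qed

text \<open>Values are indexed by the cells themselves, so enlarging \<open>C\<close> renames its
  index. This is why the same value \<open>x\<close> sits at \<open>insert (Suc m) C\<close> on one
  side and at \<open>C\<close> on the other.\<close>

lemma expand_extend_cell:
  assumes p: "partition_on {1..m} p" and C: "C \<in> p"
  shows "expand (Suc m) (insert (insert (Suc m) C) (p - {C})) (w(insert (Suc m) C := x)) =
    (expand m p (w(C := x)))(Suc m := x)"
proof
  fix i
  let ?q = "insert (insert (Suc m) C) (p - {C})"
  have q: "partition_on {1..Suc m} ?q"
    using partition_on_extend_cell[OF p _ C, of "Suc m"] by (simp add: atLeastAtMostSuc_conv)
  have Suc_notin: "Suc m \<notin> D" if "D \<in> p" for D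
  proof -
    have "Suc m \<notin> \<Union>p" unfolding partition_onD1[OF p, symmetric] by simp
    with that show ?thesis by blast
  qed
  consider "i \<in> insert (Suc m) C" | "i \<in> {1..m}" "i \<notin> C" | "i \<notin> {1..Suc m}"
    by (force simp: atLeastAtMostSuc_conv)
  then show "expand (Suc m) ?q (w(insert (Suc m) C := x)) i = ((expand m p (w(C := x)))(Suc m := x)) i"
  proof cases
    case 1
    then have "cell_of ?q i = insert (Suc m) C"
      using cell_of_eq[OF q] by simp
    moreover have "cell_of p i = C" "i \<in> {1..m}" if "i \<noteq> Suc m"
      using that 1 cell_of_eq[OF p C] C partition_onD1[OF p] by auto
    ultimately show ?thesis
      by (auto simp: expand_def)
  next
    case 2
    have D: "cell_of p i \<in> p" "i \<in> cell_of p i"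
      using cell_of_in[OF p 2(1)] cell_of_contains[OF p 2(1)] by auto
    then have "cell_of p i \<noteq> C" using 2 by auto
    with D have "cell_of ?q i = cell_of p i"
      using cell_of_eq[OF q] by simp
    then show ?thesis
      using 2 \<open>cell_of p i \<noteq> C\<close> Suc_notin[OF D(1)] by (auto simp: expand_def)
  next
    case 3
    then have "i \<noteq> Suc m" "i \<notin> {1..m}" by auto
    with 3 show ?thesis by (simp add: expand_outside del: atLeastAtMost_iff)
  qed
qed

text \<open>Cells are nonempty, so each value \<open>w C\<close> is taken by some
  coordinate.\<close>

lemma image_expand:
  assumes p: "partition_on {1..m} p"
  shows "expand m p w ` {1..m} = w ` p"
proof -
  have "cell_of p ` {1..m} = p"
  proof
    show "cell_of p ` {1..m} \<subseteq> p" using cell_of_in[OF p] by auto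
    show "p \<subseteq> cell_of p ` {1..m}"
    proof
      fix C assume C: "C \<in> p"
      then obtain i where "i \<in> C" using partition_onD3[OF p] by (metis ex_in_conv)
      then have "i \<in> {1..m}" "C = cell_of p i"
        using C partition_onD1[OF p] cell_of_eq[OF p C] by auto
      then show "C \<in> cell_of p ` {1..m}" by blast
    qed
  qed
  moreover have "expand m p w ` {1..m} = w ` cell_of p ` {1..m}"
    by (auto simp: expand_def)
  ultimately show ?thesis by simp
qed

text \<open>For two different cells, integrate the coordinate of \<open>C\<close> first: with
  \<open>w D\<close> fixed, a tie confines it to one point, which has mass 0. There are finitely
  many pairs of cells.\<close>

lemma AE_PiM_nonatomic_inj_on:
  fixes \<nu> :: "'a::polish_space measure"
  assumes \<nu>: "\<nu> \<in> bfm_set" and atom: "nonatomic \<nu>" and p: "finite p"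
  shows "AE w in (\<Pi>\<^sub>M C\<in>p. \<nu>). inj_on w p"
proof -
  interpret product_sigma_finite "\<lambda>_. \<nu>"
    by (rule product_sigma_finite_bfm[OF \<nu>])
  note [measurable_cong] = sets_bfm_set[OF \<nu>]
  have ne: "AE w in (\<Pi>\<^sub>M C\<in>p. \<nu>). w C \<noteq> w D" if CD: "C \<in> p" "D \<in> p" "C \<noteq> D" for C D
  proof -
    have comp [measurable]: "(\<lambda>w. w E) \<in> borel_measurable (\<Pi>\<^sub>M C\<in>p. \<nu>)" if "E \<in> p" for E
      using measurable_component_singleton[OF that, of "\<lambda>_. \<nu>"]
      by (simp add: measurable_cong_sets[OF refl sets_bfm_set[OF \<nu>]])
    let ?Z = "{w \<in> space (\<Pi>\<^sub>M C\<in>p. \<nu>). w C = w D}"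
    have Z: "?Z \<in> sets (\<Pi>\<^sub>M C\<in>p. \<nu>)"
      using CD by (intro measurable_equality_set comp)
    have pC: "insert C (p - {C}) = p" using CD by auto
    have "emeasure (\<Pi>\<^sub>M C\<in>p. \<nu>) ?Z = (\<integral>\<^sup>+w. indicator ?Z w \<partial>(\<Pi>\<^sub>M C\<in>insert C (p - {C}). \<nu>))"
      unfolding pC using Z by simp
    also have "\<dots> = (\<integral>\<^sup>+w. \<integral>\<^sup>+x. indicator ?Z (w(C := x)) \<partial>\<nu> \<partial>(\<Pi>\<^sub>M C\<in>p - {C}. \<nu>))"
      using p Z pC by (intro product_nn_integral_insert) auto
    also have "\<dots> = (\<integral>\<^sup>+w. 0 \<partial>(\<Pi>\<^sub>M C\<in>p - {C}. \<nu>))"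
    proof (rule nn_integral_cong)
      fix w
      have "(\<integral>\<^sup>+x. indicator ?Z (w(C := x)) \<partial>\<nu>) \<le> (\<integral>\<^sup>+x. indicator {w D} x \<partial>\<nu>)"
        using CD by (intro nn_integral_mono) (auto simp: indicator_def)
      also have "\<dots> = 0"
        using atom by (simp add: nonatomic_def sets_bfm_set[OF \<nu>])
      finally show "(\<integral>\<^sup>+x. indicator ?Z (w(C := x)) \<partial>\<nu>) = 0" by simp
    qed
    finally have "emeasure (\<Pi>\<^sub>M C\<in>p. \<nu>) ?Z = 0" by simp
    with Z show ?thesis
      by (intro AE_I[of _ _ ?Z]) auto
  qed
  have "AE w in (\<Pi>\<^sub>M C\<in>p. \<nu>). \<forall>C\<in>p. \<forall>D\<in>p. C \<noteq> D \<longrightarrow> w C \<noteq> w D"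
    using p ne by (intro AE_finite_allI AE_impI) auto
  then show ?thesis
    by eventually_elim (auto simp: inj_on_def)
qed

section \<open>Recursion on the number of coordinates\<close>

lemma sets_sequential_measure [simp, measurable_cong]:
  "sets (sequential_measure m \<nu>) = sets (\<Pi>\<^sub>M i\<in>{1..m}. borel)"
  by (cases m) simp_all

lemma space_sequential_measure: "space (sequential_measure m \<nu>) = space (\<Pi>\<^sub>M i\<in>{1..m}. borel)"
  by (rule sets_eq_imp_space_eq) simp

lemma measurable_nn_integral_step:
  fixes \<nu> :: "'a::polish_space measure"
  assumes \<nu>: "\<nu> \<in> bfm_set" and g: "g \<in> borel_measurable (\<Pi>\<^sub>M i\<in>{1..Suc m}. borel)"
  shows "(\<lambda>W. \<integral>\<^sup>+x. g (W(Suc m := x)) \<partial>add_dirac \<nu> (W ` {1..m})) \<in> borel_measurable (\<Pi>\<^sub>M i\<in>{1..m}. borel)"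
  using measurable_nn_integral_kernel[OF measurable_add_dirac_fixed[OF \<nu>, of m],
      of "\<lambda>z. g ((fst z)(Suc m := snd z))"] measurable_compose[OF measurable_fun_upd_Suc g]
  by (simp add: case_prod_beta)

lemma measurable_fun_upd_fixed:
  assumes "W \<in> space (\<Pi>\<^sub>M i\<in>{1..m}. borel)"
  shows "(\<lambda>x. W(Suc m := x)) \<in> measurable borel (\<Pi>\<^sub>M i\<in>{1..Suc m}. borel)"
  using measurable_compose[OF measurable_Pair1'[OF assms] measurable_fun_upd_Suc] by simp

lemma nn_integral_sequential_measure_Suc:
  fixes \<nu> :: "'a::polish_space measure"
  assumes \<nu>: "\<nu> \<in> bfm_set" and g: "g \<in> borel_measurable (\<Pi>\<^sub>M i\<in>{1..Suc m}. borel)"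
  shows "(\<integral>\<^sup>+W. g W \<partial>sequential_measure (Suc m) \<nu>) =
    (\<integral>\<^sup>+W. \<integral>\<^sup>+x. g (W(Suc m := x)) \<partial>add_dirac \<nu> (W ` {1..m}) \<partial>sequential_measure m \<nu>)"
proof -
  let ?K = "\<Pi>\<^sub>M i\<in>{1..Suc m}. (borel :: 'a measure)"
  define \<kappa> where "\<kappa> W = distr (add_dirac \<nu> (W ` {1..m})) ?K (\<lambda>x. W(Suc m := x))" for W
  have \<kappa>: "(\<integral>\<^sup>+V. h V \<partial>\<kappa> W) = (\<integral>\<^sup>+x. h (W(Suc m := x)) \<partial>add_dirac \<nu> (W ` {1..m}))"
    if "h \<in> borel_measurable ?K" "W \<in> space (\<Pi>\<^sub>M i\<in>{1..m}. borel)" for h W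
    unfolding \<kappa>_def using that(1) measurable_fun_upd_fixed[OF that(2)]
    by (intro nn_integral_distr) (simp_all add: measurable_cong_sets[OF sets_add_dirac refl])
  have meas: "(\<lambda>W. emeasure (\<kappa> W) A) \<in> borel_measurable (sequential_measure m \<nu>)" if A: "A \<in> sets ?K" for A
  proof -
    have "(\<lambda>W. \<integral>\<^sup>+x. indicator A (W(Suc m := x)) \<partial>add_dirac \<nu> (W ` {1..m}) :: ennreal)
        \<in> borel_measurable (\<Pi>\<^sub>M i\<in>{1..m}. borel)"
      by (rule measurable_nn_integral_step[OF \<nu>]) (use A in simp)
    moreover have "emeasure (\<kappa> W) A = (\<integral>\<^sup>+x. indicator A (W(Suc m := x)) \<partial>add_dirac \<nu> (W ` {1..m}))"
      if "W \<in> space (\<Pi>\<^sub>M i\<in>{1..m}. borel)" for W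
      using \<kappa>[of "indicator A" W] that A by (simp add: \<kappa>_def)
    ultimately have "(\<lambda>W. emeasure (\<kappa> W) A) \<in> borel_measurable (\<Pi>\<^sub>M i\<in>{1..m}. borel)"
      by (simp cong: measurable_cong)
    then show ?thesis
      by (simp add: measurable_cong_sets[OF sets_sequential_measure refl])
  qed
  have "(\<integral>\<^sup>+W. g W \<partial>sequential_measure (Suc m) \<nu>) = (\<integral>\<^sup>+W. \<integral>\<^sup>+V. g V \<partial>\<kappa> W \<partial>sequential_measure m \<nu>)"
    unfolding sequential_measure.simps \<kappa>_def[symmetric]
    using meas g by (intro nn_integral_mixture) (simp_all add: \<kappa>_def)
  also have "\<dots> = (\<integral>\<^sup>+W. \<integral>\<^sup>+x. g (W(Suc m := x)) \<partial>add_dirac \<nu> (W ` {1..m}) \<partial>sequential_measure m \<nu>)"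
    by (intro nn_integral_cong \<kappa>[OF g]) (simp add: space_sequential_measure)
  finally show ?thesis .
qed

text \<open>A partition with the new index as a singleton cell contributes an integral of a fresh
  coordinate against \<open>\<nu>\<close>. Those that put it into an old cell \<open>C\<close>
  repeat the value \<open>w C\<close>, and together they give the unit masses at the distinct
  values.\<close>

lemma nn_integral_tie_measure_Suc:
  fixes \<nu> :: "'a::polish_space measure"
  assumes \<nu>: "\<nu> \<in> bfm_set" and atom: "nonatomic \<nu>" and g: "g \<in> borel_measurable (\<Pi>\<^sub>M i\<in>{1..Suc m}. borel)"
  shows "(\<integral>\<^sup>+W. g W \<partial>tie_measure (Suc m) \<nu>) =
    (\<integral>\<^sup>+W. \<integral>\<^sup>+x. g (W(Suc m := x)) \<partial>add_dirac \<nu> (W ` {1..m}) \<partial>tie_measure m \<nu>)"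
proof -
  interpret product_sigma_finite "\<lambda>_. \<nu>"
    by (rule product_sigma_finite_bfm[OF \<nu>])
  note sets\<nu> = sets_bfm_set[OF \<nu>]
  let ?U = "\<lambda>q. \<integral>\<^sup>+w. g (expand (Suc m) q w) \<partial>(\<Pi>\<^sub>M C\<in>q. \<nu>)"
  have g_expand: "(\<lambda>w. g (expand (Suc m) q w)) \<in> borel_measurable (\<Pi>\<^sub>M C\<in>q. \<nu>)"
    if "partition_on {1..Suc m} q" for q
    by (rule measurable_compose[OF measurable_expand[OF that sets\<nu>] g])
  have step: "?U (insert {Suc m} p) + (\<Sum>C\<in>p. ?U (insert (insert (Suc m) C) (p - {C}))) =
      (\<integral>\<^sup>+w. \<integral>\<^sup>+x. g ((expand m p w)(Suc m := x)) \<partial>add_dirac \<nu> (expand m p w ` {1..m}) \<partial>(\<Pi>\<^sub>M C\<in>p. \<nu>))"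
    if p: "partition_on {1..m} p" for p
  proof -
    have finp: "finite p" using finite_elements[OF _ p] by simp
    have Suc_notin: "Suc m \<notin> D" if "D \<in> p" for D
    proof -
      have "Suc m \<notin> \<Union>p" unfolding partition_onD1[OF p, symmetric] by simp
      with that show ?thesis by blast
    qed
    have meas_upd: "(\<lambda>w. g ((expand m p (fst w))(Suc m := snd w))) \<in> borel_measurable ((\<Pi>\<^sub>M C\<in>p. \<nu>) \<Otimes>\<^sub>M borel)"
    proof -
      have "(\<lambda>w. (expand m p (fst w), snd w)) \<in> measurable ((\<Pi>\<^sub>M C\<in>p. \<nu>) \<Otimes>\<^sub>M borel) ((\<Pi>\<^sub>M i\<in>{1..m}. borel) \<Otimes>\<^sub>M borel)"
        using measurable_compose[OF measurable_fst measurable_expand[OF p sets\<nu>]] by measurable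
      from measurable_compose[OF measurable_compose[OF this measurable_fun_upd_Suc] g] show ?thesis
        by simp
    qed
    have comp: "(\<lambda>w. w C) \<in> borel_measurable (\<Pi>\<^sub>M C\<in>p. \<nu>)" if "C \<in> p" for C
      using measurable_component_singleton[OF that, of "\<lambda>_. \<nu>"]
      by (simp add: measurable_cong_sets[OF refl sets\<nu>])
    have meas_C: "(\<lambda>w. g ((expand m p w)(Suc m := w C))) \<in> borel_measurable (\<Pi>\<^sub>M C\<in>p. \<nu>)" if "C \<in> p" for C
    proof -
      have "(\<lambda>w. (w, w C)) \<in> measurable (\<Pi>\<^sub>M C\<in>p. \<nu>) ((\<Pi>\<^sub>M C\<in>p. \<nu>) \<Otimes>\<^sub>M borel)"
        using comp[OF that] by measurable
      from measurable_compose[OF this meas_upd] show ?thesis by simp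
    qed
    interpret sigma_finite_measure \<nu> by (rule sigma_finite_bfm[OF \<nu>])
    have meas_int: "(\<lambda>w. \<integral>\<^sup>+x. g ((expand m p w)(Suc m := x)) \<partial>\<nu>) \<in> borel_measurable (\<Pi>\<^sub>M C\<in>p. \<nu>)"
    proof (rule borel_measurable_nn_integral)
      have "sets ((\<Pi>\<^sub>M C\<in>p. \<nu>) \<Otimes>\<^sub>M \<nu>) = sets ((\<Pi>\<^sub>M C\<in>p. \<nu>) \<Otimes>\<^sub>M borel)"
        by (intro sets_pair_measure_cong refl sets\<nu>)
      then show "(\<lambda>(w, x). g ((expand m p w)(Suc m := x))) \<in> borel_measurable ((\<Pi>\<^sub>M C\<in>p. \<nu>) \<Otimes>\<^sub>M \<nu>)"
        unfolding case_prod_beta by (rule measurable_cong_sets[OF _ refl, THEN equalityD2, THEN subsetD]) (rule meas_upd)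
    qed
    have "partition_on {1..Suc m} (insert {Suc m} p)"
      using partition_on_singleton_insert[OF p, of "Suc m"] by (simp add: atLeastAtMostSuc_conv)
    note part = this
    have "{Suc m} \<notin> p" using Suc_notin[of "{Suc m}"] by blast
    from product_nn_integral_insert[OF finp this g_expand[OF part]]
    have new: "?U (insert {Suc m} p) =
        (\<integral>\<^sup>+w. \<integral>\<^sup>+x. g ((expand m p w)(Suc m := x)) \<partial>\<nu> \<partial>(\<Pi>\<^sub>M C\<in>p. \<nu>))"
      unfolding expand_singleton_cell[OF p] .
    \<comment> \<open>The index sets of the two products differ only in the name of one cell.
      Splitting off that coordinate on either side leaves the same product over
      \<open>p - {C}\<close>.\<close>
    have old: "?U (insert (insert (Suc m) C) (p - {C})) =
        (\<integral>\<^sup>+w. g ((expand m p w)(Suc m := w C)) \<partial>(\<Pi>\<^sub>M C\<in>p. \<nu>))" if C: "C \<in> p" for C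
    proof -
      have "partition_on {1..Suc m} (insert (insert (Suc m) C) (p - {C}))"
        using partition_on_extend_cell[OF p _ C, of "Suc m"] by (simp add: atLeastAtMostSuc_conv)
      note part = this
      have fin: "finite (p - {C})" using finp by simp
      have "insert (Suc m) C \<notin> p - {C}" using Suc_notin[of "insert (Suc m) C"] by blast
      from product_nn_integral_insert[OF fin this g_expand[OF part]]
      have "?U (insert (insert (Suc m) C) (p - {C})) =
          (\<integral>\<^sup>+w. \<integral>\<^sup>+x. g ((expand m p (w(C := x)))(Suc m := x)) \<partial>\<nu> \<partial>(\<Pi>\<^sub>M C\<in>p - {C}. \<nu>))"
        unfolding expand_extend_cell[OF p C] .
      also have "\<dots> = (\<integral>\<^sup>+w. g ((expand m p w)(Suc m := w C)) \<partial>(\<Pi>\<^sub>M C\<in>p. \<nu>))"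
        using product_nn_integral_insert[OF fin, of C "\<lambda>w. g ((expand m p w)(Suc m := w C))"]
          meas_C[OF C] insert_Diff[OF C] by simp
      finally show ?thesis .
    qed
    have "?U (insert {Suc m} p) + (\<Sum>C\<in>p. ?U (insert (insert (Suc m) C) (p - {C}))) =
        (\<integral>\<^sup>+w. \<integral>\<^sup>+x. g ((expand m p w)(Suc m := x)) \<partial>\<nu> \<partial>(\<Pi>\<^sub>M C\<in>p. \<nu>)) +
        (\<integral>\<^sup>+w. (\<Sum>C\<in>p. g ((expand m p w)(Suc m := w C))) \<partial>(\<Pi>\<^sub>M C\<in>p. \<nu>))"
      using meas_C by (simp add: new old nn_integral_sum)
    also have "\<dots> = (\<integral>\<^sup>+w. (\<integral>\<^sup>+x. g ((expand m p w)(Suc m := x)) \<partial>\<nu>) +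
        (\<Sum>C\<in>p. g ((expand m p w)(Suc m := w C))) \<partial>(\<Pi>\<^sub>M C\<in>p. \<nu>))"
      using meas_int meas_C by (intro nn_integral_add[symmetric]) auto
    also have "\<dots> = (\<integral>\<^sup>+w. \<integral>\<^sup>+x. g ((expand m p w)(Suc m := x)) \<partial>add_dirac \<nu> (expand m p w ` {1..m}) \<partial>(\<Pi>\<^sub>M C\<in>p. \<nu>))"
    proof (rule nn_integral_cong_AE)
      \<comment> \<open>The sum on the left runs over cells, whereas \<open>add_dirac\<close> sums
        over distinct values. The two agree when \<open>w\<close> is injective on \<open>p\<close>,
        which holds almost everywhere.\<close>
      show "AE w in (\<Pi>\<^sub>M C\<in>p. \<nu>). (\<integral>\<^sup>+x. g ((expand m p w)(Suc m := x)) \<partial>\<nu>) +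
          (\<Sum>C\<in>p. g ((expand m p w)(Suc m := w C))) =
          (\<integral>\<^sup>+x. g ((expand m p w)(Suc m := x)) \<partial>add_dirac \<nu> (expand m p w ` {1..m}))"
        using AE_PiM_nonatomic_inj_on[OF \<nu> atom finp]
      proof eventually_elim
        case (elim w)
        have "expand m p w \<in> space (\<Pi>\<^sub>M i\<in>{1..m}. borel)"
          by (auto simp: expand_def space_PiM)
        from measurable_compose[OF measurable_fun_upd_fixed[OF this] g]
        show ?case
          using elim finp by (subst nn_integral_add_dirac[OF \<nu>]) (simp_all add: image_expand[OF p] sum.reindex)
      qed
    qed
    finally show ?thesis .
  qed
  have "(\<integral>\<^sup>+W. g W \<partial>tie_measure (Suc m) \<nu>) = (\<Sum>q | partition_on (insert (Suc m) {1..m}) q. ?U q)"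
    by (simp add: nn_integral_tie_measure[OF sets\<nu> g] atLeastAtMostSuc_conv)
  also have "\<dots> = (\<Sum>p | partition_on {1..m} p.
      ?U (insert {Suc m} p) + (\<Sum>C\<in>p. ?U (insert (insert (Suc m) C) (p - {C}))))"
    by (rule sum_partition_on_insert) auto
  also have "\<dots> = (\<Sum>p | partition_on {1..m} p. \<integral>\<^sup>+w. \<integral>\<^sup>+x. g ((expand m p w)(Suc m := x))
      \<partial>add_dirac \<nu> (expand m p w ` {1..m}) \<partial>(\<Pi>\<^sub>M C\<in>p. \<nu>))"
    by (intro sum.cong refl step) simp
  also have "\<dots> = (\<integral>\<^sup>+W. \<integral>\<^sup>+x. g (W(Suc m := x)) \<partial>add_dirac \<nu> (W ` {1..m}) \<partial>tie_measure m \<nu>)"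
    by (rule nn_integral_tie_measure[OF sets\<nu> measurable_nn_integral_step[OF \<nu> g], symmetric])
  finally show ?thesis .
qed

lemma nn_integral_tie_eq_sequential:
  fixes \<nu> :: "'a::polish_space measure"
  assumes \<nu>: "\<nu> \<in> bfm_set" and atom: "nonatomic \<nu>" and g: "g \<in> borel_measurable (\<Pi>\<^sub>M i\<in>{1..m}. borel)"
  shows "(\<integral>\<^sup>+W. g W \<partial>tie_measure m \<nu>) = (\<integral>\<^sup>+W. g W \<partial>sequential_measure m \<nu>)"
  using g
proof (induction m arbitrary: g)
  case 0
  \<comment> \<open>The empty set has the empty partition only, so both measures are the unit mass
    at the empty vector.\<close>
  have "{p. partition_on {} p} = {{} :: nat set set}"
    by (auto simp: partition_on_empty)
  then show ?case
    using 0 by (simp add: nn_integral_tie_measure[OF sets_bfm_set[OF \<nu>]] PiM_empty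
        nn_integral_count_space_finite expand_def restrict_def)
next
  case (Suc m)
  show ?case
    unfolding nn_integral_tie_measure_Suc[OF \<nu> atom Suc.prems] nn_integral_sequential_measure_Suc[OF \<nu> Suc.prems]
    by (rule Suc.IH[OF measurable_nn_integral_step[OF \<nu> Suc.prems]])
qed

lemma sets_tie_measure [simp, measurable_cong]:
  "sets (tie_measure m \<nu>) = sets (\<Pi>\<^sub>M i\<in>{1..m}. borel)"
  by (simp add: tie_measure_def)

lemma tie_measure_eq_sequential_measure:
  fixes \<nu> :: "'a::polish_space measure"
  assumes "\<nu> \<in> bfm_set" "nonatomic \<nu>"
  shows "tie_measure m \<nu> = sequential_measure m \<nu>"
proof (rule measure_eqI)
  fix A assume "A \<in> sets (tie_measure m \<nu>)"
  then show "emeasure (tie_measure m \<nu>) A = emeasure (sequential_measure m \<nu>) A"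
    using nn_integral_tie_eq_sequential[OF assms, of "indicator A" m] by simp
qed simp

section \<open>The multivariate formula\<close>

lemma add_dirac_empty: "N \<in> bfm_set \<Longrightarrow> add_dirac N {} = N"
  by (intro measure_eqI) (simp_all add: sets_bfm_set emeasure_add_dirac)

text \<open>For \<open>x\<close> in \<open>S\<close> the left side would charge \<open>x\<close>
  twice and the right side once.\<close>

lemma add_dirac_insert:
  assumes N: "N \<in> bfm_set" and S: "finite S" "x \<notin> S"
  shows "add_dirac (add_dirac N {x}) S = add_dirac N (insert x S)"
  using S by (intro measure_eqI)
    (simp_all add: emeasure_add_dirac sets_bfm_set[OF N] add.assoc)

lemma measurable_power_integral:
  fixes g :: "(nat \<Rightarrow> 'a) \<times> 'a::polish_space measure \<Rightarrow> ennreal"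
  assumes g: "g \<in> borel_measurable ((\<Pi>\<^sub>M i\<in>{1..Suc m}. borel) \<Otimes>\<^sub>M bfm)"
  shows "(\<lambda>z. \<integral>\<^sup>+x. g ((fst z)(Suc m := x), snd z) \<partial>snd z) \<in> borel_measurable ((\<Pi>\<^sub>M i\<in>{1..m}. borel) \<Otimes>\<^sub>M bfm)"
proof -
  let ?M = "(\<Pi>\<^sub>M i\<in>{1..m}. borel :: 'a measure) \<Otimes>\<^sub>M (bfm :: 'a measure measure)"
  have "(\<lambda>z. (fst (fst z), snd z)) \<in> measurable (?M \<Otimes>\<^sub>M borel) ((\<Pi>\<^sub>M i\<in>{1..m}. borel) \<Otimes>\<^sub>M (borel :: 'a measure))"
    by measurable
  from measurable_compose[OF this measurable_fun_upd_Suc]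
  have "(\<lambda>z. (fst (fst z))(Suc m := snd z)) \<in> measurable (?M \<Otimes>\<^sub>M borel) (\<Pi>\<^sub>M i\<in>{1..Suc m}. borel)"
    by simp
  then have "(\<lambda>z. ((fst (fst z))(Suc m := snd z), snd (fst z))) \<in>
      measurable (?M \<Otimes>\<^sub>M (borel :: 'a measure)) ((\<Pi>\<^sub>M i\<in>{1..Suc m}. borel) \<Otimes>\<^sub>M bfm)"
    by (intro measurable_Pair) simp_all
  from measurable_nn_integral_kernel[OF measurable_snd measurable_compose[OF this g]]
  show ?thesis by simp
qed

lemma measurable_shifted:
  fixes g :: "(nat \<Rightarrow> 'a) \<times> 'a::polish_space measure \<Rightarrow> ennreal"
  assumes g: "g \<in> borel_measurable ((\<Pi>\<^sub>M i\<in>{1..n}. borel) \<Otimes>\<^sub>M bfm)"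
  shows "(\<lambda>z. g (fst z, add_dirac (snd z) (fst z ` {1..n}))) \<in> borel_measurable ((\<Pi>\<^sub>M i\<in>{1..n}. borel) \<Otimes>\<^sub>M bfm)"
  using measurable_compose[OF measurable_Pair[OF measurable_fst measurable_add_dirac_pair[of n]] g]
  by (simp add: case_prod_beta)

lemma measurable_nn_integral_shifted:
  fixes g :: "(nat \<Rightarrow> 'a) \<times> 'a::polish_space measure \<Rightarrow> ennreal"
  assumes P: "poisson_law \<nu> P" and g: "g \<in> borel_measurable ((\<Pi>\<^sub>M i\<in>{1..n}. borel) \<Otimes>\<^sub>M bfm)"
  shows "(\<lambda>W. \<integral>\<^sup>+N. g (W, add_dirac N (W ` {1..n})) \<partial>P) \<in> borel_measurable (\<Pi>\<^sub>M i\<in>{1..n}. borel)"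
proof -
  interpret prob_space P by (rule poisson_law_prob_space[OF P])
  have "sets ((\<Pi>\<^sub>M i\<in>{1..n}. borel :: 'a measure) \<Otimes>\<^sub>M P) = sets ((\<Pi>\<^sub>M i\<in>{1..n}. borel) \<Otimes>\<^sub>M bfm)"
    by (intro sets_pair_measure_cong refl poisson_law_sets[OF P])
  then have "(\<lambda>z. g (fst z, add_dirac (snd z) (fst z ` {1..n}))) \<in> borel_measurable ((\<Pi>\<^sub>M i\<in>{1..n}. borel) \<Otimes>\<^sub>M P)"
    by (rule measurable_cong_sets[OF _ refl, THEN equalityD2, THEN subsetD]) (rule measurable_shifted[OF g])
  then show ?thesis
    using borel_measurable_nn_integral[of "\<lambda>W N. g (W, add_dirac N (W ` {1..n}))" "\<Pi>\<^sub>M i\<in>{1..n}. borel"]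
    by (simp add: case_prod_beta)
qed

text \<open>In the induction step the last coordinate is integrated with
  respect to \<open>N\<close> plus the unit masses at the earlier values: the masses produce the ties, and \<open>N\<close>
  itself is handled by the univariate formula, which creates a point different from the earlier
  ones because \<open>\<nu>\<close> is nonatomic.\<close>

lemma nn_integral_poisson_mecke_power:
  fixes \<nu> :: "'a::polish_space measure" and g :: "(nat \<Rightarrow> 'a) \<times> 'a measure \<Rightarrow> ennreal"
  assumes \<nu>: "\<nu> \<in> bfm_set" and atom: "nonatomic \<nu>" and P: "poisson_law \<nu> P"
    and g: "g \<in> borel_measurable ((\<Pi>\<^sub>M i\<in>{1..n}. borel) \<Otimes>\<^sub>M bfm)"
  shows "(\<integral>\<^sup>+N. \<integral>\<^sup>+W. g (W, N) \<partial>(\<Pi>\<^sub>M i\<in>{1..n}. N) \<partial>P) =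
    (\<integral>\<^sup>+W. \<integral>\<^sup>+N. g (W, add_dirac N (W ` {1..n})) \<partial>P \<partial>sequential_measure n \<nu>)"
  using g
proof (induction n arbitrary: g)
  case 0
  have "(\<integral>\<^sup>+N. \<integral>\<^sup>+W. g (W, N) \<partial>(\<Pi>\<^sub>M i\<in>{1..0}. N) \<partial>P) = (\<integral>\<^sup>+N. g (\<lambda>_. undefined, N) \<partial>P)"
    by (simp add: PiM_empty nn_integral_count_space_finite)
  also have "\<dots> = (\<integral>\<^sup>+N. g (\<lambda>_. undefined, add_dirac N {}) \<partial>P)"
    by (intro nn_integral_cong) (simp add: poisson_law_space[OF P] add_dirac_empty)
  also have "\<dots> = (\<integral>\<^sup>+W. \<integral>\<^sup>+N. g (W, add_dirac N (W ` {1..0})) \<partial>P \<partial>sequential_measure 0 \<nu>)"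
    by (simp add: PiM_empty nn_integral_count_space_finite)
  finally show ?case .
next
  case (Suc m)
  note g = Suc.prems
  interpret prob_space P by (rule poisson_law_prob_space[OF P])
  \<comment> \<open>The last coordinate is integrated against the second component. The induction
    hypothesis replaces \<open>N\<close> there by \<open>N\<close> plus the earlier masses, so the
    measure of integration is shifted as well.\<close>
  define h where "h z = (\<integral>\<^sup>+x. g ((fst z)(Suc m := x), snd z) \<partial>snd z)" for z
  have h: "h \<in> borel_measurable ((\<Pi>\<^sub>M i\<in>{1..m}. borel) \<Otimes>\<^sub>M bfm)"
    unfolding h_def by (rule measurable_power_integral[OF g])
  define G where "G W = (\<integral>\<^sup>+N. g (W, add_dirac N (W ` {1..Suc m})) \<partial>P)" for W
  have G: "G \<in> borel_measurable (\<Pi>\<^sub>M i\<in>{1..Suc m}. borel)"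
    unfolding G_def by (rule measurable_nn_integral_shifted[OF P g])
  have gN: "(\<lambda>W. g (W, N)) \<in> borel_measurable (\<Pi>\<^sub>M i\<in>{1..Suc m}. borel)" if "N \<in> bfm_set" for N
    using g that by (intro measurable_compose[OF measurable_Pair2' g]) simp
  have step: "(\<integral>\<^sup>+N. h (W, add_dirac N (W ` {1..m})) \<partial>P) =
      (\<integral>\<^sup>+x. G (W(Suc m := x)) \<partial>add_dirac \<nu> (W ` {1..m}))"
    if W: "W \<in> space (\<Pi>\<^sub>M i\<in>{1..m}. borel)" for W
  proof -
    let ?S = "W ` {1..m}"
    \<comment> \<open>The masses at the earlier values are absorbed into the integrand, so that the
      univariate formula applies to \<open>N\<close> itself.\<close>
    define k where "k z = g (W(Suc m := fst z), add_dirac (snd z) ?S)" for z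
    note upd = measurable_fun_upd_fixed[OF W]
    have "(\<lambda>z. (W(Suc m := fst z), add_dirac (snd z) ?S)) \<in>
        measurable (borel \<Otimes>\<^sub>M bfm) ((\<Pi>\<^sub>M i\<in>{1..Suc m}. borel) \<Otimes>\<^sub>M bfm)"
      by (intro measurable_Pair measurable_compose[OF measurable_fst upd]
          measurable_compose[OF measurable_snd measurable_add_dirac]) simp
    from measurable_compose[OF this g]
    have k: "k \<in> borel_measurable (borel \<Otimes>\<^sub>M bfm)" by (simp add: k_def[abs_def])
    have kN: "(\<lambda>x. k (x, N)) \<in> borel_measurable borel" if "N \<in> bfm_set" for N
      using that by (intro measurable_compose[OF measurable_Pair2' k]) simp
    have kx: "(\<lambda>N. k (x, N)) \<in> borel_measurable P" for x
      unfolding measurable_poisson_law[OF P] by (intro measurable_compose[OF measurable_Pair1' k]) simp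
    have kI: "(\<lambda>N. \<integral>\<^sup>+x. k (x, N) \<partial>N) \<in> borel_measurable P"
      unfolding measurable_poisson_law[OF P] by (rule measurable_nn_integral_self[OF k])
    have "(\<integral>\<^sup>+N. h (W, add_dirac N ?S) \<partial>P) = (\<integral>\<^sup>+N. (\<integral>\<^sup>+x. k (x, N) \<partial>N) + (\<Sum>x\<in>?S. k (x, N)) \<partial>P)"
    proof (rule nn_integral_cong)
      fix N assume "N \<in> space P"
      then have N: "N \<in> bfm_set" using poisson_law_space[OF P] by simp
      show "h (W, add_dirac N ?S) = (\<integral>\<^sup>+x. k (x, N) \<partial>N) + (\<Sum>x\<in>?S. k (x, N))"
        using nn_integral_add_dirac[OF N _ kN[OF N], of ?S] by (simp add: h_def k_def)
    qed
    also have "\<dots> = (\<integral>\<^sup>+N. \<integral>\<^sup>+x. k (x, N) \<partial>N \<partial>P) + (\<Sum>x\<in>?S. \<integral>\<^sup>+N. k (x, N) \<partial>P)"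
      using kx kI by (simp add: nn_integral_add nn_integral_sum)
    also have "(\<integral>\<^sup>+N. \<integral>\<^sup>+x. k (x, N) \<partial>N \<partial>P) = (\<integral>\<^sup>+x. \<integral>\<^sup>+N. k (x, add_dirac N {x}) \<partial>P \<partial>\<nu>)"
      by (rule nn_integral_poisson_mecke[OF \<nu> P k])
    also have "\<dots> = (\<integral>\<^sup>+x. G (W(Suc m := x)) \<partial>\<nu>)"
    proof (rule nn_integral_cong_AE)
      \<comment> \<open>Outside the finite null set \<open>?S\<close> the new point is a new
        distinct value, so adding it and then \<open>?S\<close> is the same as adding the enlarged
        set.\<close>
      have "emeasure \<nu> ?S = 0"
        using atom by (subst emeasure_eq_sum_singleton)
          (auto simp: sets_bfm_set[OF \<nu>] nonatomic_def)
      then have "AE x in \<nu>. x \<notin> ?S"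
        by (intro AE_not_in) (simp add: null_sets_def sets_bfm_set[OF \<nu>] finite_imp_closed)
      then show "AE x in \<nu>. (\<integral>\<^sup>+N. k (x, add_dirac N {x}) \<partial>P) = G (W(Suc m := x))"
      proof eventually_elim
        case (elim x)
        show ?case
          unfolding G_def k_def image_fun_upd_Suc using elim
          by (intro nn_integral_cong) (simp add: poisson_law_space[OF P] add_dirac_insert)
      qed
    qed
    \<comment> \<open>A repeated value leaves the set of distinct values unchanged, so no further
      mass is added at a tie.\<close>
    also have "(\<Sum>x\<in>?S. \<integral>\<^sup>+N. k (x, N) \<partial>P) = (\<Sum>x\<in>?S. G (W(Suc m := x)))"
      unfolding G_def k_def image_fun_upd_Suc by (intro sum.cong refl) (simp add: insert_absorb)
    also have "(\<integral>\<^sup>+x. G (W(Suc m := x)) \<partial>\<nu>) + (\<Sum>x\<in>?S. G (W(Suc m := x))) =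
        (\<integral>\<^sup>+x. G (W(Suc m := x)) \<partial>add_dirac \<nu> ?S)"
      by (rule nn_integral_add_dirac[OF \<nu> _ measurable_compose[OF upd G], symmetric]) simp
    finally show ?thesis .
  qed
  have "(\<integral>\<^sup>+N. \<integral>\<^sup>+W. g (W, N) \<partial>(\<Pi>\<^sub>M i\<in>{1..Suc m}. N) \<partial>P) =
      (\<integral>\<^sup>+N. \<integral>\<^sup>+W. h (W, N) \<partial>(\<Pi>\<^sub>M i\<in>{1..m}. N) \<partial>P)"
    by (intro nn_integral_cong) (simp add: poisson_law_space[OF P] nn_integral_PiM_Suc gN h_def)
  also have "\<dots> = (\<integral>\<^sup>+W. \<integral>\<^sup>+N. h (W, add_dirac N (W ` {1..m})) \<partial>P \<partial>sequential_measure m \<nu>)"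
    by (rule Suc.IH[OF h])
  also have "\<dots> = (\<integral>\<^sup>+W. \<integral>\<^sup>+x. G (W(Suc m := x)) \<partial>add_dirac \<nu> (W ` {1..m}) \<partial>sequential_measure m \<nu>)"
    by (intro nn_integral_cong step) (simp add: space_sequential_measure)
  also have "\<dots> = (\<integral>\<^sup>+W. G W \<partial>sequential_measure (Suc m) \<nu>)"
    by (rule nn_integral_sequential_measure_Suc[OF \<nu> G, symmetric])
  finally show ?case by (simp only: G_def)
qed

section \<open>Conditional law and moment measure\<close>

lemma nn_integral_law_given:
  assumes P: "poisson_law \<nu> P" and h: "h \<in> borel_measurable bfm"
  shows "(\<integral>\<^sup>+N. h N \<partial>law_given n P W) = (\<integral>\<^sup>+N. h (add_dirac N (W ` {1..n})) \<partial>P)"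
  unfolding law_given_def using h
  by (intro nn_integral_distr) (simp_all add: measurable_poisson_law[OF P])

lemma poisson_disintegration:
  fixes \<nu> :: "'a::polish_space measure" and g :: "(nat \<Rightarrow> 'a) \<times> 'a measure \<Rightarrow> ennreal"
  assumes \<nu>: "\<nu> \<in> bfm_set" and atom: "nonatomic \<nu>" and P: "poisson_law \<nu> P"
    and g: "g \<in> borel_measurable ((\<Pi>\<^sub>M i\<in>{1..n}. borel) \<Otimes>\<^sub>M bfm)"
  shows "(\<integral>\<^sup>+N. \<integral>\<^sup>+W. g (W, N) \<partial>(\<Pi>\<^sub>M i\<in>{1..n}. N) \<partial>P) =
    (\<integral>\<^sup>+W. \<integral>\<^sup>+N. g (W, N) \<partial>law_given n P W \<partial>tie_measure n \<nu>)"
  unfolding nn_integral_poisson_mecke_power[OF assms] tie_measure_eq_sequential_measure[OF \<nu> atom]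
proof (rule nn_integral_cong)
  fix W assume "W \<in> space (sequential_measure n \<nu>)"
  then have "(\<lambda>N. g (W, N)) \<in> borel_measurable bfm"
    by (intro measurable_compose[OF measurable_Pair1' g]) (simp add: space_sequential_measure)
  then show "(\<integral>\<^sup>+N. g (W, add_dirac N (W ` {1..n})) \<partial>P) = (\<integral>\<^sup>+N. g (W, N) \<partial>law_given n P W)"
    by (rule nn_integral_law_given[OF P, symmetric])
qed

lemma law_given_bfm:
  assumes P: "poisson_law \<nu> P"
  shows "prob_space (law_given n P W)" "sets (law_given n P W) = sets bfm"
proof -
  interpret prob_space P by (rule poisson_law_prob_space[OF P])
  show "prob_space (law_given n P W)"
    unfolding law_given_def by (intro prob_space_distr) (simp add: measurable_poisson_law[OF P])
qed (simp add: law_given_def)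

text \<open>This is the disintegration for functions of \<open>W\<close> alone: the conditional laws
  have total mass 1 and integrate out.\<close>

lemma moment_measure_eq_tie_measure:
  fixes \<nu> :: "'a::polish_space measure"
  assumes \<nu>: "\<nu> \<in> bfm_set" and atom: "nonatomic \<nu>" and P: "poisson_law \<nu> P"
  shows "moment_measure n P = tie_measure n \<nu>"
proof (rule measure_eqI)
  interpret prob_space P by (rule poisson_law_prob_space[OF P])
  let ?K = "\<Pi>\<^sub>M i\<in>{1..n}. (borel :: 'a measure)"
  show "sets (moment_measure n P) = sets (tie_measure n \<nu>)"
    by (simp add: moment_measure_def)
  fix A assume "A \<in> sets (moment_measure n P)"
  then have A: "A \<in> sets ?K" by (simp add: moment_measure_def)
  have power: "emeasure (\<Pi>\<^sub>M i\<in>{1..n}. N) B = (\<integral>\<^sup>+W. indicator B W \<partial>(\<Pi>\<^sub>M i\<in>{1..n}. N))"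
    if "N \<in> space P" "B \<in> sets ?K" for N B
    using that sets_PiM_bfm_set[of N "{1..n}"] poisson_law_space[OF P] by simp
  have "emeasure (moment_measure n P) A = (\<integral>\<^sup>+N. emeasure (\<Pi>\<^sub>M i\<in>{1..n}. N) A \<partial>P)"
    unfolding moment_measure_def
  proof (rule emeasure_mixture[OF _ _ A])
    show "sets (\<Pi>\<^sub>M i\<in>{1..n}. N) = sets ?K" if "N \<in> space P" for N
      using that sets_PiM_bfm_set[of N "{1..n}"] poisson_law_space[OF P] by simp
    fix B assume B: "B \<in> sets ?K"
    have "(\<lambda>N. \<integral>\<^sup>+W. indicator B W \<partial>(\<Pi>\<^sub>M i\<in>{1..n}. N) :: ennreal) \<in> borel_measurable bfm"
      using measurable_nn_integral_power[OF measurable_ident_sets[OF refl],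
          where g = "\<lambda>z. indicator B (snd z)" and n = n] B by simp
    then have "(\<lambda>N. \<integral>\<^sup>+W. indicator B W \<partial>(\<Pi>\<^sub>M i\<in>{1..n}. N) :: ennreal) \<in> borel_measurable P"
      by (simp add: measurable_poisson_law[OF P])
    then show "(\<lambda>N. emeasure (\<Pi>\<^sub>M i\<in>{1..n}. N) B) \<in> borel_measurable P"
      by (rule measurable_cong[THEN iffD2, rotated]) (rule power[OF _ B])
  qed
  also have "\<dots> = (\<integral>\<^sup>+N. \<integral>\<^sup>+W. indicator A W \<partial>(\<Pi>\<^sub>M i\<in>{1..n}. N) \<partial>P)"
    by (intro nn_integral_cong power A)
  also have "\<dots> = (\<integral>\<^sup>+W. \<integral>\<^sup>+N. indicator A W \<partial>law_given n P W \<partial>tie_measure n \<nu>)"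
    using poisson_disintegration[OF \<nu> atom P, of "\<lambda>z. indicator A (fst z)" n] A by simp
  also have "\<dots> = (\<integral>\<^sup>+W. indicator A W \<partial>tie_measure n \<nu>)"
    by (simp add: prob_space.emeasure_space_1[OF law_given_bfm(1)[OF P]])
  finally show "emeasure (moment_measure n P) A = emeasure (tie_measure n \<nu>) A"
    using A by simp
qed

lemma laplace_law_given:
  assumes P: "poisson_law \<nu> P" and f: "f \<in> BM_plus"
  shows "laplace (law_given n P W) f = laplace P f * (\<Prod>x\<in>W ` {1..n}. exp (- f x))"
proof -
  have "laplace (law_given n P W) f =
      (\<integral>N. exp_neg (\<integral>\<^sup>+x. ennreal (f x) \<partial>add_dirac N (W ` {1..n})) \<partial>P)"
    unfolding laplace_def law_given_def
    by (intro integral_distr measurable_exp_neg_nn_integral[OF f]) (simp add: measurable_poisson_law[OF P])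
  also have "\<dots> = (\<integral>N. exp_neg (\<integral>\<^sup>+x. ennreal (f x) \<partial>N) * (\<Prod>x\<in>W ` {1..n}. exp (- f x)) \<partial>P)"
    by (intro Bochner_Integration.integral_cong)
       (simp_all add: poisson_law_space[OF P] nn_integral_add_dirac_BM_plus f)
  finally show ?thesis by (simp add: laplace_def)
qed

text \<open>The converse direction is uniqueness of Laplace functionals: a law whose functional has
  this form coincides with the law of the shifted configuration.\<close>

lemma law_given_iff_laplace:
  assumes P: "poisson_law \<nu> P"
  shows "Q = law_given n P W \<longleftrightarrow> prob_space Q \<and> sets Q = sets bfm \<and>
    (\<forall>f\<in>BM_plus. laplace Q f = laplace P f * (\<Prod>x\<in>W ` {1..n}. exp (- f x)))"
proof (intro iffI conjI ballI)
  assume Q: "prob_space Q \<and> sets Q = sets bfm \<and>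
    (\<forall>f\<in>BM_plus. laplace Q f = laplace P f * (\<Prod>x\<in>W ` {1..n}. exp (- f x)))"
  show "Q = law_given n P W"
  proof (rule finite_measure_bfm_eqI_laplace)
    show "finite_measure Q" "finite_measure (law_given n P W)"
      using Q law_given_bfm(1)[OF P] by (auto intro: prob_space.finite_measure)
  qed (use Q in \<open>simp_all add: law_given_bfm[OF P] laplace_law_given[OF P]\<close>)
qed (simp_all add: law_given_bfm[OF P] laplace_law_given[OF P])

theorem proposition2p2:
  fixes \<nu> :: "'a::polish_space measure" and P :: "'a measure measure" and n :: nat
  assumes "\<nu> \<in> bfm_set"
    and "sigma_finite_measure \<nu>"
    and "nonatomic \<nu>"
    and "poisson_law \<nu> P"
    and "n \<ge> 1"
  shows
    "(\<forall>g\<in>borel_measurable ((\<Pi>\<^sub>M i\<in>{1..n}. borel) \<Otimes>\<^sub>M bfm).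
        (\<integral>\<^sup>+N. (\<integral>\<^sup>+W. g (W, N) \<partial>(\<Pi>\<^sub>M i\<in>{1..n}. N)) \<partial>P) =
        (\<integral>\<^sup>+W. (\<integral>\<^sup>+N. g (W, N) \<partial>law_given n P W) \<partial>tie_measure n \<nu>)) \<and>
     (\<forall>W\<in>space (\<Pi>\<^sub>M i\<in>{1..n}. borel). \<forall>Q.
        Q = law_given n P W \<longleftrightarrow>
        prob_space Q \<and> sets Q = sets bfm \<and>
        (\<forall>f\<in>BM_plus. laplace Q f = laplace P f * (\<Prod>x\<in>W ` {1..n}. exp (- f x)))) \<and>
     moment_measure n P = tie_measure n \<nu> \<and>
     tie_measure n \<nu> = sequential_measure n \<nu>"
proof (intro conjI ballI allI)
  show "(\<integral>\<^sup>+N. (\<integral>\<^sup>+W. g (W, N) \<partial>(\<Pi>\<^sub>M i\<in>{1..n}. N)) \<partial>P) =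
      (\<integral>\<^sup>+W. (\<integral>\<^sup>+N. g (W, N) \<partial>law_given n P W) \<partial>tie_measure n \<nu>)"
    if "g \<in> borel_measurable ((\<Pi>\<^sub>M i\<in>{1..n}. borel) \<Otimes>\<^sub>M bfm)" for g
    by (rule poisson_disintegration[OF assms(1,3,4) that])
  show "Q = law_given n P W \<longleftrightarrow> prob_space Q \<and> sets Q = sets bfm \<and>
      (\<forall>f\<in>BM_plus. laplace Q f = laplace P f * (\<Prod>x\<in>W ` {1..n}. exp (- f x)))" for W Q
    by (rule law_given_iff_laplace[OF assms(4)])
  show "moment_measure n P = tie_measure n \<nu>"
    by (rule moment_measure_eq_tie_measure[OF assms(1,3,4)])
  show "tie_measure n \<nu> = sequential_measure n \<nu>"
    by (rule tie_measure_eq_sequential_measure[OF assms(1,3)])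
qed

end
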